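(* Let $(\mathcal X,\mathcal B(\mathcal X))$ be a measurable space and let $\{P^{\vartheta}(x,\cdot)\}_{x\in\mathcal X}$, $\vartheta\in\Theta$, be a family of transition probabilities on it; for each $\vartheta$ let $(\Phi_n)_{n\ge 0}$ be the homogeneous Markov chain with transition probability $P^{\vartheta}$, and let $\mathbf E^{\vartheta}_x$ be the expectation for the chain started at $x$. Let $C\in\mathcal B(\mathcal X)$ and assume the following two conditions, with the same set $C$. (1) There exist $0<\delta<1$ and a probability measure $\nu$ on $\mathcal B(\mathcal X)$ with $\nu(C)=1$ such that for every $A\in\mathcal B(\mathcal X)$ with $\nu(A)>0$, $$\inf_{x\in C}\Big(\inf_{\vartheta\in\Theta}P^{\vartheta}(x,A)-\delta\nu(A)\Big)>0 .$$ (2) There exist a function $V:\mathcal X\to[1,\infty)$ and constants $0<\rho<1$, $D\ge 1$ such that $V^*=\sup_{x\in C}V(x)<\infty$ and, for every $x\in\mathcal X$, $$\sup_{\vartheta\in\Theta}\mathbf E^{\vartheta}_x V(\Phi_1)\le(1-\rho)V(x)+D\,\mathbf 1_C(x).$$ Then for each $\vartheta\in\Theta$ the chain admits an invariant distribution $\pi^{\vartheta}$ on $\mathcal B(\mathcal X)$. Moreover, for any $n\ge 2$, $$\sup_{\vartheta\in\Theta}\ \sup_{x\in\mathcal X}\ \sup_{0<f\le V}\ \frac1{V(x)}\left|\mathbf E^{\vartheta}_x f(\Phi_n)-\int_{\mathcal X}f(z)\,\pi^{\vartheta}(dz)\right|\le R^*e^{-\kappa^* n},$$ where $R^*$ and $\kappa^*$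 are the explicit constants (computed from $\rho,\delta,D,\eta,V^*$ and an arbitrary fixed $\gamma\in(0,1)$) given in the context, with $$\eta=\inf_{x\in C}\Big(\inf_{\vartheta\in\Theta}P^{\vartheta}(x,C)-\delta\Big).$$
   Context: All functions $V$ and $f$ on $\mathcal X$ are measurable; the supremum over $f$ is over functions with $0<f\le V$. $[a]$ denotes the integer part of $a$. The constants are defined as follows. Fix any $0<\gamma<1$ and put $\eta_1=\eta/(1-\delta)$, $$\check U^*=\max\left(\frac{1-\rho+D}{(1-\delta)(1-\rho)^{1-\gamma}\left(1-(1-\rho)^{\gamma}\right)},\ \frac{V^*}{(1-\rho)^{1-\gamma}}\right),\qquad B^*=\check U^*\left(1+\frac{\check U^*V^*}{1-(1-\delta\eta_1)^{\gamma}}\right),$$ $$r_*=\frac{(1-\gamma)^2|\ln(1-\rho)|\,|\ln(1-\delta\eta_1)|}{\ln(\check U^*V^* )+|\ln(1-\delta\eta_1)|},$$ $$\check B_1^*=\min\left(e^{-r_*},\frac{\delta}{e^{r_*}-1+\delta\eta_1}\right),\qquad \tilde q=\frac{1-\check B_1^*}{2},$$ $$\tilde l=2+\left[\frac{\ln(V^*B^* )}{r_*}+\frac{\ln\left(\tilde q\,(1-e^{-r_*})^{-1}\right)}{2r_*}\right],$$ $$\tilde A=\frac{V^*B^*+1}{(1-e^{-r_*})(1-e^{-\gamma r_*})},\qquad \tilde r=|\ln(1-\tilde q)|,\qquad \tilde\epsilon=\delta\eta_1(1-\delta)^{\tilde l-2},$$ $$\tilde\varrho_1=\frac{(1-\gamma)^2\,\tilde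 r\,|\ln(1-\tilde\epsilon)|}{\ln\tilde A+r_*\tilde l+|\ln(1-\tilde\epsilon)|},\qquad \tilde\kappa=\frac{(1-\gamma)\tilde\varrho_1 r_*}{\tilde\varrho_1+\ln(V^*B^* )},$$ $$\tilde A_3=\frac{1-\gamma}{\gamma}\left(3+2\,\frac{e^{r_*}\tilde A\left(1+\tilde A e^{r_*\tilde l}\right)}{\left(1-(1-\tilde\epsilon)^{\gamma}\right)(e^{r_*}-1)}\right)V^*B^*+e^{\tilde\kappa}.$$ Finally $$\kappa^*=\frac{(1-\gamma)\tilde\varrho_1r_*}{2(\tilde\varrho_1+\ln(V^*B^* ))},\qquad R^*=2\,\frac{(\tilde A_3+1)e^{\kappa^*}+1}{e^{\kappa^*}-1}\,V^*(B^* )^2 .$$ *)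

theory Defs
  imports "HOL-Probability.Probability"
begin

section \<open>Markov chains with a given transition kernel\<close>

definition transition_prob :: "'a measure \<Rightarrow> ('a \<Rightarrow> 'a measure) \<Rightarrow> bool" where
  "transition_prob M K \<longleftrightarrow> K \<in> M \<rightarrow>\<^sub>M prob_algebra M"

text \<open>Conditional law of the state at time \<open>n\<close> given the path before time \<open>n\<close>,
  in the form expected by the Ionescu-Tulcea construction.\<close>

definition chain_step ::
    "'a measure \<Rightarrow> ('a \<Rightarrow> 'a measure) \<Rightarrow> 'a \<Rightarrow> nat \<Rightarrow> (nat \<Rightarrow> 'a) \<Rightarrow> 'a measure" where
  "chain_step M K x n \<omega> = (case n of 0 \<Rightarrow> return M x | Suc m \<Rightarrow> K (\<omega> m))"

text \<open>The law on the path space of the homogeneous Markov chain with transition kernel \<open>K\<close>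
  started at \<open>x\<close>: the Ionescu-Tulcea extension. The chain is the coordinate process, so the
  \<open>n\<close>-th state is \<open>\<omega> n\<close>. The value is unspecified unless \<^term>\<open>transition_prob M K\<close>
  and \<^term>\<open>x \<in> space M\<close>.\<close>

definition chain_law ::
    "'a measure \<Rightarrow> ('a \<Rightarrow> 'a measure) \<Rightarrow> 'a \<Rightarrow> (nat \<Rightarrow> 'a) measure" where
  "chain_law M K x =
     projective_family.lim UNIV (Ionescu_Tulcea.CI (chain_step M K x) (\<lambda>_. M)) (\<lambda>_. M)"

lemma Ionescu_Tulcea_chain_step:
  assumes K: "transition_prob M K" and x: "x \<in> space M"
  shows "Ionescu_Tulcea (chain_step M K x) (\<lambda>_. M)"
proof (rule Ionescu_Tulcea.intro)
  have K': "K \<in> M \<rightarrow>\<^sub>M subprob_algebra M"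
    using K by (simp add: transition_prob_def measurable_prob_algebraD)
  show "chain_step M K x i \<in> Pi\<^sub>M {0..<i} (\<lambda>_. M) \<rightarrow>\<^sub>M subprob_algebra M" for i
  proof (cases i)
    case 0
    then show ?thesis using x
      by (auto simp: chain_step_def[abs_def] space_subprob_algebra prob_space_return prob_space_imp_subprob_space)
  next
    case (Suc m)
    have "(\<lambda>\<omega>. \<omega> m) \<in> Pi\<^sub>M {0..<Suc m} (\<lambda>_. M) \<rightarrow>\<^sub>M M"
      by (rule measurable_component_singleton) auto
    from measurable_compose[OF this K'] show ?thesis
      using Suc by (simp add: chain_step_def[abs_def])
  qed
  fix i and \<omega> :: "nat \<Rightarrow> 'a" assume that: "\<omega> \<in> space (Pi\<^sub>M {0..<i} (\<lambda>_. M))"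
  show "prob_space (chain_step M K x i \<omega>)"
  proof (cases i)
    case 0
    then show ?thesis using x by (simp add: chain_step_def prob_space_return)
  next
    case (Suc m)
    then have "\<omega> m \<in> space M" using that by (auto simp: space_PiM PiE_iff)
    then have "K (\<omega> m) \<in> space (prob_algebra M)"
      using K by (auto simp: transition_prob_def dest: measurable_space)
    then show ?thesis using Suc by (simp add: chain_step_def space_prob_algebra)
  qed
qed

lemma
  assumes K: "transition_prob M K" and x: "x \<in> space M"
  shows sets_chain_law: "sets (chain_law M K x) = sets (Pi\<^sub>M UNIV (\<lambda>_. M))"
    and prob_space_chain_law: "prob_space (chain_law M K x)"
    and chain_law_0: "distr (chain_law M K x) M (\<lambda>\<omega>. \<omega> 0) = return M x"
    and chain_law_Suc: "distr (chain_law M K x) M (\<lambda>\<omega>. \<omega> (Suc n)) =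
          distr (chain_law M K x) M (\<lambda>\<omega>. \<omega> n) \<bind> K"
proof -
  interpret IT: Ionescu_Tulcea "chain_step M K x" "\<lambda>_. M"
    by (rule Ionescu_Tulcea_chain_step[OF K x])
  let ?L = "chain_law M K x"
  have L: "?L = IT.PF.lim" by (simp add: chain_law_def)
  have sL: "sets ?L = sets (Pi\<^sub>M UNIV (\<lambda>_. M))"
    unfolding L by (rule IT.PF.sets_lim)
  then show "sets (chain_law M K x) = sets (Pi\<^sub>M UNIV (\<lambda>_. M))" .
  have K': "K \<in> M \<rightarrow>\<^sub>M subprob_algebra M"
    using K by (simp add: transition_prob_def measurable_prob_algebraD)
  have up: "IT.up_to {0..<n} = n" for n
    using IT.up_to_iff_Ico[of "{0..<n}" n] IT.up_to[of "{0..<n}"]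
    by (cases n) auto
  have CI: "IT.CI {0..<n} = IT.C 0 n (\<lambda>_. undefined)" for n
    using IT.distr_C[of n n "\<lambda>_. undefined" 0] by (simp add: IT.CI_def up space_PiM)
  have fd: "distr ?L (Pi\<^sub>M {0..<n} (\<lambda>_. M)) (\<lambda>\<omega>. restrict \<omega> {0..<n}) = IT.C 0 n (\<lambda>_. undefined)" for n
    unfolding L using IT.distr_lim[of "{0..<n}"] by (simp add: CI)
  have u: "(\<lambda>_. undefined) \<in> space (Pi\<^sub>M {0..<0::nat} (\<lambda>_. M))" by (auto simp: space_PiM PiE_iff extensional_def)
  have mr: "(\<lambda>\<omega>. restrict \<omega> {0..<n}) \<in> ?L \<rightarrow>\<^sub>M Pi\<^sub>M {0..<n} (\<lambda>_. M)" for n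
    unfolding measurable_cong_sets[OF sL refl] by (rule measurable_restrict_subset) auto
  show pL: "prob_space ?L"
    by (rule prob_space_distrD[OF mr[of 0]]) (simp add: fd[of 0, simplified] IT.prob_space_C[OF u, of 0, simplified])
  have co: "distr ?L M (\<lambda>\<omega>. \<omega> n) = distr (IT.C 0 (Suc n) (\<lambda>_. undefined)) M (\<lambda>\<omega>. \<omega> n)" for n
    unfolding fd[symmetric]
    by (subst distr_distr[OF _ mr]) (auto intro!: distr_cong measurable_component_singleton)
  have last: "distr (IT.eP n \<omega>) M (\<lambda>\<omega>. \<omega> n) = chain_step M K x n \<omega>"
    if "\<omega> \<in> space (Pi\<^sub>M {0..<n} (\<lambda>_. M))" for n \<omega>
    unfolding IT.eP_def using that
    by (subst distr_distr)
       (auto simp: comp_def IT.sets_P intro!: measurable_component_singleton measurable_fun_upd[where J="{0..<n}"] distr_id2)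
  have *: "distr ?L M (\<lambda>\<omega>. \<omega> n) = IT.C 0 n (\<lambda>_. undefined) \<bind> chain_step M K x n" for n
  proof -
    have ne: "space (IT.C 0 n (\<lambda>_. undefined)) \<noteq> {}"
      using IT.prob_space_C[OF u] by (rule prob_space.not_empty)
    have "distr ?L M (\<lambda>\<omega>. \<omega> n) = distr (IT.C 0 n (\<lambda>_. undefined) \<bind> IT.eP n) M (\<lambda>\<omega>. \<omega> n)"
      by (simp add: co)
    also have "\<dots> = IT.C 0 n (\<lambda>_. undefined) \<bind> (\<lambda>\<omega>. distr (IT.eP n \<omega>) M (\<lambda>\<omega>. \<omega> n))"
      using IT.measurable_eP[of n] ne
      by (intro distr_bind[where K="Pi\<^sub>M {0..<Suc n} (\<lambda>_. M)"])
         (auto simp: measurable_cong_sets[OF IT.sets_C[OF u]] intro!: measurable_component_singleton)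
    also have "\<dots> = IT.C 0 n (\<lambda>_. undefined) \<bind> chain_step M K x n"
      using IT.space_C[OF u, of n] by (intro bind_cong refl last) simp
    finally show ?thesis .
  qed
  show "distr ?L M (\<lambda>\<omega>. \<omega> 0) = return M x"
  proof -
    have "chain_step M K x 0 = (\<lambda>_. return M x)"
      by (auto simp: chain_step_def)
    then show ?thesis
      unfolding *[of 0] using IT.prob_space_C[OF u, of 0] prob_space_return[OF x]
      by (simp only: bind_const' prob_space_imp_subprob_space)
  qed
  have "distr ?L M (\<lambda>\<omega>. \<omega> (Suc n)) = IT.C 0 (Suc n) (\<lambda>_. undefined) \<bind> (\<lambda>\<omega>. K (\<omega> n))"
    unfolding *[of "Suc n"] by (simp add: chain_step_def[abs_def])
  also have "\<dots> = distr (IT.C 0 (Suc n) (\<lambda>_. undefined)) M (\<lambda>\<omega>. \<omega> n) \<bind> K"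
    using prob_space.not_empty[OF IT.prob_space_C[OF u, of "Suc n"]]
    by (subst bind_distr[OF _ K'])
       (auto simp: measurable_cong_sets[OF IT.sets_C[OF u]] simp del: IT.C.simps intro!: measurable_component_singleton)
  also have "\<dots> = distr ?L M (\<lambda>\<omega>. \<omega> n) \<bind> K" by (simp only: co)
  finally show "distr ?L M (\<lambda>\<omega>. \<omega> (Suc n)) = distr ?L M (\<lambda>\<omega>. \<omega> n) \<bind> K" .
qed

definition invariant_distribution :: "'a measure \<Rightarrow> ('a \<Rightarrow> 'a measure) \<Rightarrow> 'a measure \<Rightarrow> bool" where
  "invariant_distribution M K \<mu> \<longleftrightarrow>
     prob_space \<mu> \<and> sets \<mu> = sets M \<and>
     (\<forall>A\<in>sets M. emeasure \<mu> A = (\<integral>\<^sup>+ x. emeasure (K x) A \<partial>\<mu>))"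

section \<open>The explicit constants\<close>

text \<open>The parameter \<open>v\<close> is the supremum of the Lyapunov function over the small set.
  Each constant becomes a function of those of the parameters \<open>\<gamma> \<rho> \<delta> D \<eta> v\<close>
  (in this order) on which it depends.\<close>

context
  fixes \<gamma> \<rho> \<delta> D \<eta> v :: real
begin

definition eta1 :: real where
  "eta1 = \<eta> / (1 - \<delta>)"

definition U_star :: real where
  "U_star = max
     ((1 - \<rho> + D) / ((1 - \<delta>) * (1 - \<rho>) powr (1 - \<gamma>) * (1 - (1 - \<rho>) powr \<gamma>)))
     (v / (1 - \<rho>) powr (1 - \<gamma>))"

definition B_star :: real where
  "B_star = U_star * (1 + U_star * v / (1 - (1 - \<delta> * eta1) powr \<gamma>))"

definition r_star :: real where
  "r_star = (1 - \<gamma>)\<^sup>2 * \<bar>ln (1 - \<rho>)\<bar> * \<bar>ln (1 - \<delta> * eta1)\<bar>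
     / (ln (U_star * v) + \<bar>ln (1 - \<delta> * eta1)\<bar>)"

definition B1_star :: real where
  "B1_star = min (exp (- r_star)) (\<delta> / (exp r_star - 1 + \<delta> * eta1))"

definition q_tilde :: real where
  "q_tilde = (1 - B1_star) / 2"

text \<open>For admissible parameters the argument of the integer part is nonnegative,
  so that the integer part is the floor.\<close>

definition l_tilde :: int where
  "l_tilde = 2 + \<lfloor>ln (v * B_star) / r_star
     + ln (q_tilde * inverse (1 - exp (- r_star))) / (2 * r_star)\<rfloor>"

definition A_tilde :: real where
  "A_tilde = (v * B_star + 1) / ((1 - exp (- r_star)) * (1 - exp (- \<gamma> * r_star)))"

definition r_tilde :: real where
  "r_tilde = \<bar>ln (1 - q_tilde)\<bar>"

definition epsilon_tilde :: real where
  "epsilon_tilde = \<delta> * eta1 * (1 - \<delta>) powi (l_tilde - 2)"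

definition rho1_tilde :: real where
  "rho1_tilde = (1 - \<gamma>)\<^sup>2 * r_tilde * \<bar>ln (1 - epsilon_tilde)\<bar>
     / (ln A_tilde + r_star * of_int l_tilde + \<bar>ln (1 - epsilon_tilde)\<bar>)"

definition kappa_tilde :: real where
  "kappa_tilde = (1 - \<gamma>) * rho1_tilde * r_star / (rho1_tilde + ln (v * B_star))"

definition A3_tilde :: real where
  "A3_tilde = (1 - \<gamma>) / \<gamma>
     * (3 + 2 * (exp r_star * A_tilde * (1 + A_tilde * exp (r_star * of_int l_tilde))
               / ((1 - (1 - epsilon_tilde) powr \<gamma>) * (exp r_star - 1))))
     * v * B_star + exp kappa_tilde"

definition kappa_star :: real where
  "kappa_star = (1 - \<gamma>) * rho1_tilde * r_star / (2 * (rho1_tilde + ln (v * B_star)))"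

definition R_star :: real where
  "R_star = 2 * (((A3_tilde + 1) * exp kappa_star + 1) / (exp kappa_star - 1)) * v * B_star\<^sup>2"

end

end

theory Submission
  imports Defs
begin

text \<open>
For one kernel \<open>K\<close> of the family the theorem is a quantitative form of Harris' theorem.
Put \<open>a = 1 - \<rho>\<close>. The drift alone gives
\<open>K\<^sup>n V \<le> a\<^sup>n V + (1 - a\<^sup>n) D / \<rho>\<close>. Drift and minorization together give, by one
induction on \<open>m\<close>, the lower bound \<open>K\<^sup>m(x, \<cdot>) \<ge> (1 - a\<^sup>m V(x)) \<delta>\<^sup>m \<nu>\<close> (lemma
\<open>pow_minor\<close>). If \<open>a\<^sup>m \<le> \<rho> / (7 D)\<close>, this is a uniform common component of all
\<open>K\<^sup>m(x, \<cdot>)\<close> with \<open>V(x) \<le> 4 D / \<rho>\<close>, while for pairs with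
\<open>V(x) + V(y) \<ge> 4 D / \<rho>\<close> the drift already decreases this sum. Following
Hairer and Mattingly, \<open>K\<^sup>m\<close> therefore
contracts the oscillation of functions relative to \<open>2 + \<beta> (V(x) + V(y))\<close> by the factor
\<open>1 - \<delta>\<^sup>m / 7\<close> (lemma \<open>one_step_contraction\<close>). Iterating, the laws of the chain converge
uniformly over measurable sets; the limit is a measure, it is invariant and integrates \<open>V\<close> to at
most \<open>D / \<rho>\<close>, and the distance to it decays like \<open>exp (- n \<delta>\<^sup>m / (7 m))\<close>.

The explicit constants \<open>R\<^sup>*\<close> and \<open>\<kappa>\<^sup>*\<close> are then compared with this rate. With
\<open>\<Lambda> = \<bar>ln (1 - \<rho>)\<bar>\<close> and \<open>H = 2 + ln (D / \<rho>)\<close> a block length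
\<open>m \<le> 1 + H / \<Lambda>\<close> suffices, and the claim is \<open>\<kappa>\<^sup>* \<le> \<delta>\<^sup>m / (8 m)\<close> (lemma
\<open>kappa_star_le\<close>). The quantity that makes \<open>\<kappa>\<^sup>*\<close> small is \<open>epsilon_tilde\<close>, which contains
a power of \<open>1 - \<delta>\<close> with exponent about \<open>ln (v B) / r\<close>. Here \<open>r\<close> is at most
\<open>(1 - \<gamma>)\<^sup>2 \<Lambda> \<bar>ln (1 - \<delta>)\<bar> / G\<close>, where \<open>G = ln (U v)\<close>. Since
\<open>G \<ge> ln (D / \<rho>) - ln \<gamma> \<ge> (1 - \<gamma>)\<^sup>2 H\<close> and
\<open>ln (v B)\<close> exceeds \<open>\<bar>ln \<delta>\<bar>\<close>, this exponent is large enough for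
\<open>epsilon_tilde \<le> \<delta>\<^sup>m\<close> (lemma \<open>ln_epsilon_le\<close>), uniformly
in all parameters. Finally
\<open>R\<^sup>* \<ge> 3 (D / \<rho>) / \<kappa>\<^sup>*\<close> (lemma \<open>R_star_ge\<close>) absorbs the multiplicative constant of
the contraction argument.
\<close>

section \<open>Powers of a transition kernel\<close>

primrec kernel_pow :: "'a measure \<Rightarrow> ('a \<Rightarrow> 'a measure) \<Rightarrow> nat \<Rightarrow> 'a \<Rightarrow> 'a measure" where
  "kernel_pow M K 0 = return M"
| "kernel_pow M K (Suc n) = (\<lambda>x. kernel_pow M K n x \<bind> K)"

lemma prob_kernelD:
  assumes "K \<in> M \<rightarrow>\<^sub>M prob_algebra N" "x \<in> space M"
  shows "prob_space (K x)" "sets (K x) = sets N" "space (K x) = space N"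
proof -
  have "K x \<in> space (prob_algebra N)" using assms by (rule measurable_space)
  then show "prob_space (K x)" "sets (K x) = sets N" by (auto simp: space_prob_algebra)
  then show "space (K x) = space N" by (auto dest: sets_eq_imp_space_eq)
qed

lemma measurable_kernel_pow:
  assumes "K \<in> M \<rightarrow>\<^sub>M prob_algebra M"
  shows "kernel_pow M K n \<in> M \<rightarrow>\<^sub>M prob_algebra M"
proof (induction n)
  case 0
  show ?case by simp
next
  case (Suc n)
  show ?case using measurable_bind_prob_space[OF Suc assms] by simp
qed

lemma kernel_pow_add:
  assumes K: "K \<in> M \<rightarrow>\<^sub>M prob_algebra M" and x: "x \<in> space M"
  shows "kernel_pow M K (m + n) x = kernel_pow M K m x \<bind> kernel_pow M K n"
proof (induction n)
  case 0
  show ?case using prob_kernelD(2)[OF measurable_kernel_pow[OF K] x, of m]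
    by (simp add: bind_return'')
next
  case (Suc n)
  have m: "kernel_pow M K n \<in> kernel_pow M K m x \<rightarrow>\<^sub>M subprob_algebra M"
    using measurable_prob_algebraD[OF measurable_kernel_pow[OF K, of n]]
    by (subst measurable_cong_sets[OF prob_kernelD(2)[OF measurable_kernel_pow[OF K] x] refl])
  show ?case
    using Suc by (simp add: bind_assoc[OF m measurable_prob_algebraD[OF K]])
qed

lemma kernel_pow_1:
  assumes K: "K \<in> M \<rightarrow>\<^sub>M prob_algebra M" and x: "x \<in> space M"
  shows "kernel_pow M K (Suc 0) x = K x"
  using x by (simp add: bind_return[OF measurable_prob_algebraD[OF K]])

lemma distr_chain_law:
  assumes K: "transition_prob M K" and x: "x \<in> space M"
  shows "distr (chain_law M K x) M (\<lambda>\<omega>. \<omega> n) = kernel_pow M K n x"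
  by (induction n) (simp_all add: chain_law_0[OF assms] chain_law_Suc[OF assms])

text \<open>The Tonelli form of Chapman--Kolmogorov. The test functions below are unbounded, but they are
nonnegative and integrable, so both sides can be read off from the
nonnegative integral.\<close>

lemma integral_bind_nonneg:
  fixes f :: "'b \<Rightarrow> real"
  assumes Q: "Q \<in> M \<rightarrow>\<^sub>M prob_algebra N" and \<mu>: "sets \<mu> = sets M"
    and f[measurable]: "f \<in> borel_measurable N" and nonneg: "\<And>z. z \<in> space N \<Longrightarrow> 0 \<le> f z"
    and fin: "\<And>y. y \<in> space M \<Longrightarrow> integrable (Q y) f" and fin': "integrable (\<mu> \<bind> Q) f"
  shows "integrable \<mu> (\<lambda>y. \<integral>z. f z \<partial>Q y)"
    and "(\<integral>z. f z \<partial>(\<mu> \<bind> Q)) = (\<integral>y. \<integral>z. f z \<partial>Q y \<partial>\<mu>)"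
proof -
  have sp: "space \<mu> = space M" by (rule sets_eq_imp_space_eq[OF \<mu>])
  have Q': "Q \<in> \<mu> \<rightarrow>\<^sub>M subprob_algebra N"
    using measurable_prob_algebraD[OF Q] by (simp add: measurable_cong_sets[OF \<mu> refl])
  have meas: "(\<lambda>y. \<integral>z. f z \<partial>Q y) \<in> borel_measurable \<mu>"
    by (rule measurable_compose[OF Q' integral_measurable_subprob_algebra]) fact
  have in_nonneg: "0 \<le> (\<integral>z. f z \<partial>Q y)" if "y \<in> space M" for y
    using prob_kernelD[OF Q that] nonneg by (intro integral_nonneg_AE AE_I2) auto
  have inner: "(\<integral>\<^sup>+z. ennreal (f z) \<partial>Q y) = ennreal (\<integral>z. f z \<partial>Q y)" if "y \<in> space M" for y
    using prob_kernelD[OF Q that] nonneg fin[OF that]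
    by (intro nn_integral_eq_integral AE_I2) auto
  have f': "(\<lambda>z. ennreal (f z)) \<in> borel_measurable N" by measurable
  have nn: "(\<integral>\<^sup>+z. ennreal (f z) \<partial>(\<mu> \<bind> Q)) = (\<integral>\<^sup>+y. ennreal (\<integral>z. f z \<partial>Q y) \<partial>\<mu>)"
    unfolding nn_integral_bind[OF f' Q']
    by (intro nn_integral_cong inner) (simp add: sp)
  have sb: "space (\<mu> \<bind> Q) = space N" if "space \<mu> \<noteq> {}"
    using that Q' by (intro space_bind sets_kernel) auto
  show I: "integrable \<mu> (\<lambda>y. \<integral>z. f z \<partial>Q y)"
  proof (rule integrableI_nonneg[OF meas])
    show "AE y in \<mu>. 0 \<le> (\<integral>z. f z \<partial>Q y)" using in_nonneg by (intro AE_I2) (simp add: sp)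
    have "(\<integral>\<^sup>+z. ennreal (f z) \<partial>(\<mu> \<bind> Q)) \<le> (\<integral>\<^sup>+z. ennreal (norm (f z)) \<partial>(\<mu> \<bind> Q))"
      by (intro nn_integral_mono ennreal_leI) auto
    also have "\<dots> < \<infinity>" using fin' by (simp add: integrable_iff_bounded)
    finally show "(\<integral>\<^sup>+y. ennreal (\<integral>z. f z \<partial>Q y) \<partial>\<mu>) < \<infinity>" by (simp add: nn)
  qed
  show "(\<integral>z. f z \<partial>(\<mu> \<bind> Q)) = (\<integral>y. \<integral>z. f z \<partial>Q y \<partial>\<mu>)"
  proof (cases "space \<mu> = {}")
    case True
    then show ?thesis by (simp add: bind_empty integral_eq_zero_AE Bochner_Integration.integral_empty lebesgue_integral_count_space_finite)
  next
    case False
    have "ennreal (\<integral>z. f z \<partial>(\<mu> \<bind> Q)) = (\<integral>\<^sup>+z. ennreal (f z) \<partial>(\<mu> \<bind> Q))"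
      using fin' nonneg sb[OF False] by (intro nn_integral_eq_integral[symmetric] AE_I2) auto
    also have "\<dots> = ennreal (\<integral>y. \<integral>z. f z \<partial>Q y \<partial>\<mu>)"
      unfolding nn using I in_nonneg by (intro nn_integral_eq_integral AE_I2) (auto simp: sp)
    finally show ?thesis
      using in_nonneg nonneg sb[OF False]
      by (subst (asm) ennreal_inj) (auto intro!: integral_nonneg_AE AE_I2 simp: sp prob_kernelD(3)[OF Q])
  qed
qed

section \<open>Measures with a common component\<close>

lemma dominated_integral:
  fixes \<psi> :: "'a \<Rightarrow> real"
  assumes p: "prob_space \<mu>" "prob_space \<nu>" and s: "sets \<mu> = sets \<nu>" and \<alpha>: "0 \<le> \<alpha>"
    and dom: "\<And>A. A \<in> sets \<nu> \<Longrightarrow> \<alpha> * measure \<nu> A \<le> measure \<mu> A"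
    and nonneg: "\<And>z. z \<in> space \<nu> \<Longrightarrow> 0 \<le> \<psi> z" and i: "integrable \<mu> \<psi>"
  shows "0 < \<alpha> \<Longrightarrow> integrable \<nu> \<psi>"
    and "integrable \<nu> \<psi> \<Longrightarrow> \<alpha> * (\<integral>z. \<psi> z \<partial>\<nu>) \<le> (\<integral>z. \<psi> z \<partial>\<mu>)"
proof -
  interpret \<mu>: prob_space \<mu> by fact
  interpret \<nu>: prob_space \<nu> by fact
  have sp: "space \<mu> = space \<nu>" by (rule sets_eq_imp_space_eq[OF s])
  have m: "\<psi> \<in> borel_measurable \<nu>"
    using borel_measurable_integrable[OF i] by (simp add: measurable_cong_sets[OF s refl])
  have le: "scale_measure (ennreal \<alpha>) \<nu> \<le> \<mu>"
    using dom \<alpha> by (subst le_measure)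
      (auto simp: s \<mu>.emeasure_eq_measure \<nu>.emeasure_eq_measure ennreal_mult[symmetric] intro!: ennreal_leI)
  have m': "(\<lambda>z. ennreal (\<psi> z)) \<in> borel_measurable \<nu>" using m by measurable
  have "ennreal \<alpha> * (\<integral>\<^sup>+z. ennreal (\<psi> z) \<partial>\<nu>) \<le> (\<integral>\<^sup>+z. ennreal (\<psi> z) \<partial>\<mu>)"
    using nn_integral_mono_measure[OF _ le, of "\<lambda>z. ennreal (\<psi> z)"] s
    by (simp add: nn_integral_scale_measure[OF m'])
  also have "\<dots> = ennreal (\<integral>z. \<psi> z \<partial>\<mu>)"
    using i nonneg by (intro nn_integral_eq_integral AE_I2) (auto simp: sp)
  finally have *: "ennreal \<alpha> * (\<integral>\<^sup>+z. ennreal (\<psi> z) \<partial>\<nu>) \<le> ennreal (\<integral>z. \<psi> z \<partial>\<mu>)" .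
  show "integrable \<nu> \<psi>" if "0 < \<alpha>"
  proof (rule integrableI_nonneg[OF m])
    show "AE z in \<nu>. 0 \<le> \<psi> z" using nonneg by (intro AE_I2)
    have "ennreal \<alpha> * (\<integral>\<^sup>+z. ennreal (\<psi> z) \<partial>\<nu>) < top"
      by (rule le_less_trans[OF *]) simp
    then show "(\<integral>\<^sup>+z. ennreal (\<psi> z) \<partial>\<nu>) < \<infinity>"
      using that by (auto simp: ennreal_mult_less_top)
  qed
  show "\<alpha> * (\<integral>z. \<psi> z \<partial>\<nu>) \<le> (\<integral>z. \<psi> z \<partial>\<mu>)" if "integrable \<nu> \<psi>"
  proof -
    have "(\<integral>\<^sup>+z. ennreal (\<psi> z) \<partial>\<nu>) = ennreal (\<integral>z. \<psi> z \<partial>\<nu>)"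
      using that nonneg by (intro nn_integral_eq_integral AE_I2) auto
    moreover have "0 \<le> (\<integral>z. \<psi> z \<partial>\<nu>)" "0 \<le> (\<integral>z. \<psi> z \<partial>\<mu>)"
      using nonneg by (auto intro!: integral_nonneg_AE AE_I2 simp: sp)
    ultimately show ?thesis using * \<alpha> by (simp add: ennreal_mult[symmetric])
  qed
qed

text \<open>The estimate behind the contraction. If both measures contain \<open>\<alpha> \<nu>\<close>, that part
contributes nothing to the difference of the integrals of \<open>\<phi>\<close>; coupling the two
remainders of mass \<open>1 - \<alpha>\<close> independently and integrating the oscillation bound
against the product gives the right-hand side. The remainders enter only through the positive
functionals \<open>\<psi> \<mapsto> \<integral>\<psi> d\<mu>\<^sub>i - \<alpha> \<integral>\<psi> d\<nu>\<close>, and the product integral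
is performed one variable at a time.\<close>

lemma weighted_oscillation_integral:
  fixes \<phi> V :: "'a \<Rightarrow> real"
  assumes p: "prob_space \<mu>\<^sub>1" "prob_space \<mu>\<^sub>2" "prob_space \<nu>"
    and s: "sets \<mu>\<^sub>1 = sets \<nu>" "sets \<mu>\<^sub>2 = sets \<nu>"
    and V: "integrable \<mu>\<^sub>1 V" "integrable \<mu>\<^sub>2 V" "integrable \<nu> V" "\<And>z. z \<in> space \<nu> \<Longrightarrow> 0 \<le> V z"
    and \<phi>: "integrable \<mu>\<^sub>1 \<phi>" "integrable \<mu>\<^sub>2 \<phi>" "integrable \<nu> \<phi>"
    and osc: "\<And>u w. u \<in> space \<nu> \<Longrightarrow> w \<in> space \<nu> \<Longrightarrow> \<phi> u - \<phi> w \<le> c + \<beta> * (V u + V w)"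
    and \<alpha>: "0 \<le> \<alpha>" "\<alpha> < 1" and \<beta>: "0 \<le> \<beta>"
    and dom: "\<And>A. A \<in> sets \<nu> \<Longrightarrow> \<alpha> * measure \<nu> A \<le> measure \<mu>\<^sub>1 A"
      "\<And>A. A \<in> sets \<nu> \<Longrightarrow> \<alpha> * measure \<nu> A \<le> measure \<mu>\<^sub>2 A"
  shows "(\<integral>z. \<phi> z \<partial>\<mu>\<^sub>1) - (\<integral>z. \<phi> z \<partial>\<mu>\<^sub>2)
      \<le> c * (1 - \<alpha>) + \<beta> * ((\<integral>z. V z \<partial>\<mu>\<^sub>1) + (\<integral>z. V z \<partial>\<mu>\<^sub>2))"
proof -
  interpret \<mu>1: prob_space \<mu>\<^sub>1 by fact
  interpret \<mu>2: prob_space \<mu>\<^sub>2 by fact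
  interpret \<nu>: prob_space \<nu> by fact
  define \<Lambda>1 where "\<Lambda>1 \<psi> = (\<integral>z. \<psi> z \<partial>\<mu>\<^sub>1) - \<alpha> * (\<integral>z. \<psi> z \<partial>\<nu>)" for \<psi> :: "'a \<Rightarrow> real"
  define \<Lambda>2 where "\<Lambda>2 \<psi> = (\<integral>z. \<psi> z \<partial>\<mu>\<^sub>2) - \<alpha> * (\<integral>z. \<psi> z \<partial>\<nu>)" for \<psi> :: "'a \<Rightarrow> real"
  \<comment> \<open>Integrate the oscillation bound over \<open>u\<close> with \<open>w\<close> fixed.\<close>
  have inner: "(1 - \<alpha>) * \<phi> w \<ge> \<Lambda>1 \<phi> - c * (1 - \<alpha>) - \<beta> * \<Lambda>1 V - \<beta> * (1 - \<alpha>) * V w"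
    if w: "w \<in> space \<nu>" for w
  proof -
    let ?\<psi> = "\<lambda>u. c + \<beta> * (V u + V w) - (\<phi> u - \<phi> w)"
    have "\<alpha> * (\<integral>z. ?\<psi> z \<partial>\<nu>) \<le> (\<integral>z. ?\<psi> z \<partial>\<mu>\<^sub>1)"
      using osc[OF _ w] V \<phi> by (intro dominated_integral(2)[OF p(1,3) s(1) \<alpha>(1) dom(1)]) auto
    also have "(\<integral>z. ?\<psi> z \<partial>\<nu>) = c + \<beta> * ((\<integral>z. V z \<partial>\<nu>) + V w) - ((\<integral>z. \<phi> z \<partial>\<nu>) - \<phi> w)"
      using V \<phi> by (simp add: \<nu>.prob_space)
    also have "(\<integral>z. ?\<psi> z \<partial>\<mu>\<^sub>1) = c + \<beta> * ((\<integral>z. V z \<partial>\<mu>\<^sub>1) + V w) - ((\<integral>z. \<phi> z \<partial>\<mu>\<^sub>1) - \<phi> w)"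
      using V \<phi> by (simp add: \<mu>1.prob_space)
    finally show ?thesis unfolding \<Lambda>1_def by (simp add: algebra_simps)
  qed
  let ?d = "\<Lambda>1 \<phi> - c * (1 - \<alpha>) - \<beta> * \<Lambda>1 V"
  \<comment> \<open>Integrate the resulting inequality over \<open>w\<close>.\<close>
  let ?\<psi> = "\<lambda>w. (1 - \<alpha>) * \<phi> w - (?d - \<beta> * (1 - \<alpha>) * V w)"
  have "\<alpha> * (\<integral>z. ?\<psi> z \<partial>\<nu>) \<le> (\<integral>z. ?\<psi> z \<partial>\<mu>\<^sub>2)"
    using inner V \<phi> by (intro dominated_integral(2)[OF p(2,3) s(2) \<alpha>(1) dom(2)]) auto
  also have "(\<integral>z. ?\<psi> z \<partial>\<nu>) = (1 - \<alpha>) * (\<integral>z. \<phi> z \<partial>\<nu>) - (?d - \<beta> * (1 - \<alpha>) * (\<integral>z. V z \<partial>\<nu>))"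
    using V \<phi> by (simp add: \<nu>.prob_space)
  also have "(\<integral>z. ?\<psi> z \<partial>\<mu>\<^sub>2) = (1 - \<alpha>) * (\<integral>z. \<phi> z \<partial>\<mu>\<^sub>2) - (?d - \<beta> * (1 - \<alpha>) * (\<integral>z. V z \<partial>\<mu>\<^sub>2))"
    using V \<phi> by (simp add: \<mu>2.prob_space)
  finally have "0 \<le> (1 - \<alpha>) * (\<Lambda>2 \<phi> - ?d + \<beta> * \<Lambda>2 V)"
    unfolding \<Lambda>2_def by (simp add: algebra_simps)
  then have "0 \<le> \<Lambda>2 \<phi> - ?d + \<beta> * \<Lambda>2 V" using \<alpha> by (simp add: zero_le_mult_iff)
  moreover have "\<beta> * (\<Lambda>1 V + \<Lambda>2 V) \<le> \<beta> * ((\<integral>z. V z \<partial>\<mu>\<^sub>1) + (\<integral>z. V z \<partial>\<mu>\<^sub>2))"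
  proof -
    have "0 \<le> (\<integral>z. V z \<partial>\<nu>)" using V(4) by (intro integral_nonneg_AE AE_I2) auto
    then show ?thesis using \<alpha> \<beta> unfolding \<Lambda>1_def \<Lambda>2_def
      by (intro mult_left_mono) auto
  qed
  ultimately show ?thesis unfolding \<Lambda>1_def \<Lambda>2_def by (simp add: algebra_simps)
qed

section \<open>Setwise limits of probability measures\<close>

text \<open>The Cauchy property is uniform over all measurable sets. This uniformity is what makes the limit
countably additive: along a sequence of sets decreasing to the empty set, the limit is within
\<open>e n\<close> of a single measure that tends to zero.\<close>

lemma setwise_limit_measure:
  fixes \<mu> :: "nat \<Rightarrow> 'a measure" and e :: "nat \<Rightarrow> real"
  assumes p: "\<And>n. prob_space (\<mu> n)" and s: "\<And>n. sets (\<mu> n) = sets M"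
    and e: "e \<longlonglongrightarrow> 0"
    and cauchy: "\<And>A n k. A \<in> sets M \<Longrightarrow> \<bar>measure (\<mu> (k + n)) A - measure (\<mu> n) A\<bar> \<le> e n"
  obtains \<pi> where "prob_space \<pi>" "sets \<pi> = sets M"
    "\<And>A. A \<in> sets M \<Longrightarrow> (\<lambda>n. measure (\<mu> n) A) \<longlonglongrightarrow> measure \<pi> A"
proof -
  define l where "l A = lim (\<lambda>n. measure (\<mu> n) A)" for A
  have fin: "finite_measure (\<mu> n)" for n using p[of n] by (rule prob_space.finite_measure)
  have lim: "(\<lambda>n. measure (\<mu> n) A) \<longlonglongrightarrow> l A" if A: "A \<in> sets M" for A
  proof -
    have "Cauchy (\<lambda>n. measure (\<mu> n) A)"
    proof (rule metric_CauchyI)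
      fix r :: real assume "0 < r"
      then have "\<forall>\<^sub>F n in sequentially. e n < r / 2" using e by (intro order_tendstoD(2)) auto
      then obtain N where N: "e N < r / 2" by (auto simp: eventually_sequentially)
      have "\<bar>measure (\<mu> n) A - measure (\<mu> N) A\<bar> \<le> e N" if "N \<le> n" for n
        using cauchy[OF A, of "n - N" N] that by simp
      then have "dist (measure (\<mu> n) A) (measure (\<mu> k) A) < r" if "N \<le> n" "N \<le> k" for n k
        using that N unfolding dist_real_def by (smt (verit) field_sum_of_halves)
      then show "\<exists>N. \<forall>n\<ge>N. \<forall>k\<ge>N. dist (measure (\<mu> n) A) (measure (\<mu> k) A) < r" by blast
    qed
    then show ?thesis unfolding l_def by (simp add: Cauchy_convergent_iff convergent_LIMSEQ_iff)
  qed
  have near: "\<bar>l A - measure (\<mu> n) A\<bar> \<le> e n" if A: "A \<in> sets M" for A n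
  proof -
    have "(\<lambda>k. \<bar>measure (\<mu> (k + n)) A - measure (\<mu> n) A\<bar>) \<longlonglongrightarrow> \<bar>l A - measure (\<mu> n) A\<bar>"
      by (intro tendsto_intros LIMSEQ_ignore_initial_segment lim A)
    then show ?thesis by (rule LIMSEQ_le_const2) (use cauchy[OF A] in auto)
  qed
  have l_nonneg: "0 \<le> l A" if "A \<in> sets M" for A
    using lim[OF that] by (rule LIMSEQ_le_const) auto
  have add: "l (A \<union> B) = l A + l B" if "A \<in> sets M" "B \<in> sets M" "A \<inter> B = {}" for A B
  proof (rule LIMSEQ_unique[OF lim])
    show "A \<union> B \<in> sets M" using that by auto
    have "measure (\<mu> n) (A \<union> B) = measure (\<mu> n) A + measure (\<mu> n) B" for n
      using that by (intro finite_measure.finite_measure_Union[OF fin]) (auto simp: s)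
    then show "(\<lambda>n. measure (\<mu> n) (A \<union> B)) \<longlonglongrightarrow> l A + l B"
      using tendsto_add[OF lim[OF that(1)] lim[OF that(2)]] by simp
  qed
  have empty: "l {} = 0" unfolding l_def by (simp add: lim_const)
  have top: "l (space M) = 1"
  proof (rule LIMSEQ_unique[OF lim])
    have "measure (\<mu> n) (space M) = 1" for n
      using prob_space.prob_space[OF p[of n]] sets_eq_imp_space_eq[OF s[of n]] by simp
    then show "(\<lambda>n. measure (\<mu> n) (space M)) \<longlonglongrightarrow> 1" by simp
  qed simp
  have ca: "countably_additive (sets M) (\<lambda>A. ennreal (l A))"
  proof (rule sets.empty_continuous_imp_countably_additive)
    show "positive (sets M) (\<lambda>A. ennreal (l A))" by (simp add: positive_def empty)
    show "additive (sets M) (\<lambda>A. ennreal (l A))"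
      by (auto simp: additive_def add l_nonneg)
    show "\<forall>A\<in>sets M. ennreal (l A) \<noteq> \<infinity>" by simp
    fix A :: "nat \<Rightarrow> 'a set"
    assume A: "range A \<subseteq> sets M" "decseq A" "(\<Inter>i. A i) = {}"
    have A': "A i \<in> sets M" for i using A by auto
    have "(\<lambda>i. l (A i)) \<longlonglongrightarrow> 0"
    proof (rule LIMSEQ_I)
      fix r :: real assume "0 < r"
      then have "\<forall>\<^sub>F n in sequentially. e n < r / 2" using e by (intro order_tendstoD(2)) auto
      then obtain n where n: "e n < r / 2" by (auto simp: eventually_sequentially)
      have "(\<lambda>i. measure (\<mu> n) (A i)) \<longlonglongrightarrow> measure (\<mu> n) (\<Inter>i. A i)"
        using A by (intro finite_measure.finite_Lim_measure_decseq[OF fin]) (auto simp: s)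
      then have "(\<lambda>i. measure (\<mu> n) (A i)) \<longlonglongrightarrow> 0" by (simp only: A(3) measure_empty)
      then have "\<forall>\<^sub>F i in sequentially. measure (\<mu> n) (A i) < r / 2"
        using \<open>0 < r\<close> by (intro order_tendstoD(2)) auto
      then obtain N where N: "\<And>i. N \<le> i \<Longrightarrow> measure (\<mu> n) (A i) < r / 2"
        by (auto simp: eventually_sequentially)
      have "norm (l (A i) - 0) < r" if "N \<le> i" for i
        using near[OF A', of i n] N[OF that] l_nonneg[OF A', of i] n
        by (simp add: abs_le_iff)
      then show "\<exists>N. \<forall>i\<ge>N. norm (l (A i) - 0) < r" by blast
    qed
    then show "(\<lambda>i. ennreal (l (A i))) \<longlonglongrightarrow> 0"
      using tendsto_ennrealI by fastforce
  qed
  define \<pi> where "\<pi> = measure_of (space M) (sets M) (\<lambda>A. ennreal (l A))"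
  have sp: "sets \<pi> = sets M" by (simp add: \<pi>_def)
  have em: "emeasure \<pi> A = ennreal (l A)" if "A \<in> sets M" for A
    unfolding \<pi>_def using that ca
    by (intro emeasure_measure_of_sigma sets.sigma_algebra_axioms) (auto simp: positive_def empty)
  show thesis
  proof
    show "prob_space \<pi>"
      using em[of "space M"] top sets_eq_imp_space_eq[OF sp] by (intro prob_spaceI) simp
    show "sets \<pi> = sets M" by fact
    show "(\<lambda>n. measure (\<mu> n) A) \<longlonglongrightarrow> measure \<pi> A" if "A \<in> sets M" for A
      using lim[OF that] em[OF that] l_nonneg[OF that] by (simp add: measure_def)
  qed
qed

text \<open>Fatou's lemma for setwise convergent measures: the integral of a simple function converges, and a
nonnegative integral is the supremum of those of the simple functions below it.\<close>

lemma setwise_limit_nn_integral_le: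
  fixes \<mu> :: "nat \<Rightarrow> 'a measure" and u :: "nat \<Rightarrow> ennreal"
  assumes p: "\<And>n. prob_space (\<mu> n)" "prob_space \<pi>" and s: "\<And>n. sets (\<mu> n) = sets \<pi>"
    and lim: "\<And>A. A \<in> sets \<pi> \<Longrightarrow> (\<lambda>n. measure (\<mu> n) A) \<longlonglongrightarrow> measure \<pi> A"
    and u: "\<And>n. (\<integral>\<^sup>+z. g z \<partial>\<mu> n) \<le> u n" "u \<longlonglongrightarrow> c"
  shows "(\<integral>\<^sup>+z. g z \<partial>\<pi>) \<le> c"
  unfolding nn_integral_def_finite[of \<pi> g]
proof (intro SUP_least, clarify)
  fix h assume h: "simple_function \<pi> h" "h \<le> g" "\<forall>x. h x < top"
  have fin: "finite_measure (\<mu> n)" "finite_measure \<pi>" for n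
    using p by (auto intro: prob_space.finite_measure)
  have sp: "space (\<mu> n) = space \<pi>" for n by (rule sets_eq_imp_space_eq[OF s])
  have h': "simple_function (\<mu> n) h" for n
    using h(1) unfolding simple_function_def by (simp add: s sp)
  have m: "h -` {x} \<inter> space \<pi> \<in> sets \<pi>" if "x \<in> h ` space \<pi>" for x
    using h(1) that by (auto simp: simple_function_def)
  have "(\<lambda>n. integral\<^sup>S (\<mu> n) h) \<longlonglongrightarrow> integral\<^sup>S \<pi> h"
    unfolding simple_integral_def sp
  proof (intro tendsto_sum)
    fix x assume x: "x \<in> h ` space \<pi>"
    have "(\<lambda>n. emeasure (\<mu> n) (h -` {x} \<inter> space \<pi>)) \<longlonglongrightarrow> emeasure \<pi> (h -` {x} \<inter> space \<pi>)"
      using tendsto_ennrealI[OF lim[OF m[OF x]]]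
      by (simp add: finite_measure.emeasure_eq_measure[OF fin(1)] finite_measure.emeasure_eq_measure[OF fin(2)])
    moreover have "x < top" using h(3) x by auto
    ultimately show "(\<lambda>n. x * emeasure (\<mu> n) (h -` {x} \<inter> space \<pi>))
        \<longlonglongrightarrow> x * emeasure \<pi> (h -` {x} \<inter> space \<pi>)"
      by (intro ennreal_tendsto_cmult) auto
  qed
  moreover have "integral\<^sup>S (\<mu> n) h \<le> u n" for n
  proof -
    have "integral\<^sup>S (\<mu> n) h = (\<integral>\<^sup>+z. h z \<partial>\<mu> n)"
      by (rule nn_integral_eq_simple_integral[symmetric]) fact
    also have "\<dots> \<le> (\<integral>\<^sup>+z. g z \<partial>\<mu> n)" using h(2) by (intro nn_integral_mono) (auto simp: le_fun_def)
    finally show ?thesis using u(1)[of n] by (rule order_trans)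
  qed
  ultimately show "integral\<^sup>S \<pi> h \<le> c" by (intro LIMSEQ_le[OF _ u(2)]) auto
qed

section \<open>Drift and minorization for powers of a kernel\<close>

text \<open>One transition kernel with drift rate \<open>a\<close> towards the set \<open>C\<close> and a minorization
on \<open>C\<close> by a measure that lives on \<open>C\<close>.\<close>

locale harris_kernel =
  fixes M :: "'a measure" and K :: "'a \<Rightarrow> 'a measure" and C :: "'a set" and \<nu> :: "'a measure"
    and V :: "'a \<Rightarrow> real" and \<delta> a D :: real
  assumes K: "K \<in> M \<rightarrow>\<^sub>M prob_algebra M"
    and C: "C \<in> sets M"
    and \<nu>: "prob_space \<nu>" "sets \<nu> = sets M" "measure \<nu> C = 1"
    and \<delta>: "0 < \<delta>" "\<delta> < 1"
    and minor: "\<And>x A. x \<in> C \<Longrightarrow> A \<in> sets M \<Longrightarrow> \<delta> * measure \<nu> A \<le> measure (K x) A"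
    and V_meas[measurable]: "V \<in> borel_measurable M" and V_ge_1: "\<And>x. x \<in> space M \<Longrightarrow> 1 \<le> V x"
    and a: "0 < a" "a < 1" and D: "1 \<le> D"
    and drift: "\<And>x. x \<in> space M \<Longrightarrow>
      (\<integral>\<^sup>+y. ennreal (V y) \<partial>K x) \<le> ennreal (a * V x + D * indicator C x)"
begin

abbreviation P :: "nat \<Rightarrow> 'a \<Rightarrow> 'a measure" where "P \<equiv> kernel_pow M K"

lemma P_kernel: "P n \<in> M \<rightarrow>\<^sub>M prob_algebra M"
  by (rule measurable_kernel_pow[OF K])

lemmas P_props = prob_kernelD[OF P_kernel]

lemma P_measurable: "f \<in> borel_measurable M \<Longrightarrow> x \<in> space M \<Longrightarrow> f \<in> borel_measurable (P n x)"
  by (subst measurable_cong_sets[OF P_props(2) refl])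

lemma C_space: "x \<in> C \<Longrightarrow> x \<in> space M"
  using sets.sets_into_space[OF C] by auto

lemma nn_integral_V_pow:
  assumes x: "x \<in> space M"
  shows "(\<integral>\<^sup>+y. ennreal (V y) \<partial>P n x) \<le> ennreal (a ^ n * V x + (1 - a ^ n) * (D / (1 - a)))"
proof (induction n)
  case 0
  have m: "(\<lambda>y. ennreal (V y)) \<in> borel_measurable M" by measurable
  show ?case using nn_integral_return[OF x m] by simp
next
  case (Suc n)
  have "P n x \<in> space (prob_algebra M)" using measurable_space[OF P_kernel x] .
  then have K': "K \<in> P n x \<rightarrow>\<^sub>M subprob_algebra M"
    using measurable_prob_algebraD[OF K] by (simp add: measurable_cong_sets[OF P_props(2)[OF x] refl])
  have V': "V \<in> borel_measurable (P n x)" by (rule P_measurable[OF V_meas x])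
  interpret Pn: prob_space "P n x" by (rule P_props(1)[OF x])
  have "(\<integral>\<^sup>+y. ennreal (V y) \<partial>P (Suc n) x) = (\<integral>\<^sup>+y. \<integral>\<^sup>+z. ennreal (V z) \<partial>K y \<partial>P n x)"
    unfolding kernel_pow.simps by (rule nn_integral_bind[OF _ K']) measurable
  also have "\<dots> \<le> (\<integral>\<^sup>+y. ennreal a * ennreal (V y) + ennreal D \<partial>P n x)"
  proof (intro nn_integral_mono)
    fix y assume "y \<in> space (P n x)"
    then have y: "y \<in> space M" by (simp add: P_props(3)[OF x])
    have "a * V y + D * indicator C y \<le> a * V y + D" using D by (auto simp: indicator_def)
    then have "(\<integral>\<^sup>+z. ennreal (V z) \<partial>K y) \<le> ennreal (a * V y + D)"
      using drift[OF y] by (meson ennreal_leI order_trans)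
    then show "(\<integral>\<^sup>+z. ennreal (V z) \<partial>K y) \<le> ennreal a * ennreal (V y) + ennreal D"
      using a D V_ge_1[OF y] by (simp add: ennreal_mult[symmetric] ennreal_plus[symmetric] del: ennreal_plus)
  qed
  also have "\<dots> = ennreal a * (\<integral>\<^sup>+y. ennreal (V y) \<partial>P n x) + ennreal D"
    using V' by (simp add: nn_integral_add nn_integral_cmult Pn.emeasure_space_1)
  also have "\<dots> \<le> ennreal a * ennreal (a ^ n * V x + (1 - a ^ n) * (D / (1 - a))) + ennreal D"
    by (intro add_right_mono mult_left_mono Suc) simp
  also have "\<dots> = ennreal (a * (a ^ n * V x + (1 - a ^ n) * (D / (1 - a))) + D)"
  proof -
    have "0 \<le> a ^ n * V x + (1 - a ^ n) * (D / (1 - a))"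
      using a D V_ge_1[OF x] power_le_one[of a n] by (intro add_nonneg_nonneg mult_nonneg_nonneg) auto
    then show ?thesis using a D by (simp add: ennreal_mult[symmetric] ennreal_plus[symmetric] del: ennreal_plus)
  qed
  also have "a * (a ^ n * V x + (1 - a ^ n) * (D / (1 - a))) + D
      = a ^ Suc n * V x + (1 - a ^ Suc n) * (D / (1 - a))"
  proof -
    define k where "k = D / (1 - a)"
    then have k: "D / (1 - a) = k" "D = (1 - a) * k" using a by simp_all
    show ?thesis unfolding k(1) by (subst k(2)) (simp add: algebra_simps)
  qed
  finally show ?case .
qed

lemma
  assumes x: "x \<in> space M"
  shows integrable_V_pow: "integrable (P n x) V"
    and integral_V_pow: "(\<integral>y. V y \<partial>P n x) \<le> a ^ n * V x + (1 - a ^ n) * (D / (1 - a))"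
proof -
  have nn: "AE y in P n x. 0 \<le> V y"
    using V_ge_1 by (intro AE_I2) (force simp: P_props(3)[OF x])
  show I: "integrable (P n x) V"
    using P_measurable[OF V_meas x] nn nn_integral_V_pow[OF x, of n]
    by (intro integrableI_nonneg) (auto intro: le_less_trans)
  have pos: "0 \<le> a ^ n * V x + (1 - a ^ n) * (D / (1 - a))"
    using a D V_ge_1[OF x] power_le_one[of a n] by (intro add_nonneg_nonneg mult_nonneg_nonneg) auto
  show "(\<integral>y. V y \<partial>P n x) \<le> a ^ n * V x + (1 - a ^ n) * (D / (1 - a))"
    using nn_integral_V_pow[OF x, of n] nn_integral_eq_integral[OF I nn] pos by simp
qed

lemma integral_V_pow_le:
  assumes x: "x \<in> space M"
  shows "(\<integral>y. V y \<partial>P n x) \<le> V x + D / (1 - a)"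
proof -
  have an: "0 \<le> a ^ n" "a ^ n \<le> 1" using a by (auto intro: power_le_one)
  have "a ^ n * V x \<le> 1 * V x"
    using an V_ge_1[OF x] by (intro mult_right_mono) auto
  moreover have "(1 - a ^ n) * (D / (1 - a)) \<le> 1 * (D / (1 - a))"
    using an a D by (intro mult_right_mono) auto
  ultimately show ?thesis using integral_V_pow[OF x, of n] by simp
qed

lemma integrable_pow:
  fixes f :: "'a \<Rightarrow> real"
  assumes f: "f \<in> borel_measurable M" "\<And>z. z \<in> space M \<Longrightarrow> \<bar>f z\<bar> \<le> c * V z" and x: "x \<in> space M"
  shows "integrable (P n x) f"
proof (rule Bochner_Integration.integrable_bound)
  show "integrable (P n x) (\<lambda>z. c * V z)" using integrable_V_pow[OF x] by simp
  show "f \<in> borel_measurable (P n x)" by (rule P_measurable[OF f(1) x])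
  show "AE z in P n x. norm (f z) \<le> norm (c * V z)"
    using f(2) by (intro AE_I2) (force simp: P_props(3)[OF x])
qed

lemma integral_pow_measurable:
  fixes f :: "'a \<Rightarrow> real"
  assumes "f \<in> borel_measurable M"
  shows "(\<lambda>x. \<integral>z. f z \<partial>P n x) \<in> borel_measurable M"
  by (rule measurable_compose[OF measurable_prob_algebraD[OF P_kernel] integral_measurable_subprob_algebra]) fact

lemma integral_pow_add:
  fixes f :: "'a \<Rightarrow> real"
  assumes f: "f \<in> borel_measurable M" "\<And>z. z \<in> space M \<Longrightarrow> 0 \<le> f z" "\<And>z. z \<in> space M \<Longrightarrow> f z \<le> c * V z"
    and x: "x \<in> space M"
  shows "(\<integral>z. f z \<partial>P (m + n) x) = (\<integral>y. \<integral>z. f z \<partial>P n y \<partial>P m x)"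
    and "integrable (P m x) (\<lambda>y. \<integral>z. f z \<partial>P n y)"
proof -
  have I: "integrable (P k y) f" if "y \<in> space M" for k y
    using f that by (intro integrable_pow[where c=c]) auto
  show "(\<integral>z. f z \<partial>P (m + n) x) = (\<integral>y. \<integral>z. f z \<partial>P n y \<partial>P m x)"
    "integrable (P m x) (\<lambda>y. \<integral>z. f z \<partial>P n y)"
    using integral_bind_nonneg[OF P_kernel P_props(2)[OF x] f(1,2) I] I[OF x, of "m + n"]
    unfolding kernel_pow_add[OF K x] by auto
qed

lemma integral_pow_bounds:
  fixes f :: "'a \<Rightarrow> real"
  assumes f: "f \<in> borel_measurable M" "\<And>z. z \<in> space M \<Longrightarrow> 0 \<le> f z" "\<And>z. z \<in> space M \<Longrightarrow> f z \<le> V z"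
    and x: "x \<in> space M"
  shows "0 \<le> (\<integral>z. f z \<partial>P n x)" "(\<integral>z. f z \<partial>P n x) \<le> V x + D / (1 - a)"
proof -
  show "0 \<le> (\<integral>z. f z \<partial>P n x)"
    using f(2) by (intro integral_nonneg_AE AE_I2) (auto simp: P_props(3)[OF x])
  have "(\<integral>z. f z \<partial>P n x) \<le> (\<integral>z. V z \<partial>P n x)"
    using f x by (intro integral_mono integrable_V_pow integrable_pow[where c=1])
      (auto simp: P_props(3)[OF x])
  then show "(\<integral>z. f z \<partial>P n x) \<le> V x + D / (1 - a)"
    using integral_V_pow_le[OF x, of n] by simp
qed

lemma measure_pow_add:
  assumes A: "A \<in> sets M" and x: "x \<in> space M"
  shows "measure (P (m + n) x) A = (\<integral>y. measure (P n y) A \<partial>P m x)"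
    and "integrable (P m x) (\<lambda>y. measure (P n y) A)"
proof -
  have eq: "(\<integral>z. indicator A z \<partial>P k y) = measure (P k y) A" if "y \<in> space M" for k y
    using sets.sets_into_space[OF A] P_props(3)[OF that, of k] by (simp add: Int_absorb1 Int_absorb2)
  have ind: "(indicator A :: 'a \<Rightarrow> real) \<in> borel_measurable M" "\<And>z. 0 \<le> (indicator A z :: real)"
    "\<And>z. z \<in> space M \<Longrightarrow> indicator A z \<le> 1 * V z"
    using A V_ge_1 by (auto simp: indicator_def intro: order_trans[OF zero_le_one])
  note add = integral_pow_add[OF ind x, of m n]
  have I: "integrable (P m x) (\<lambda>y. \<integral>z. indicator A z \<partial>P n y :: real)" by (rule add(2))
  note add(1)
  also have "(\<integral>y. \<integral>z. indicator A z \<partial>P n y \<partial>P m x) = (\<integral>y. measure (P n y) A \<partial>P m x)"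
    by (intro Bochner_Integration.integral_cong refl eq) (simp add: P_props(3)[OF x])
  finally show "measure (P (m + n) x) A = (\<integral>y. measure (P n y) A \<partial>P m x)" by (simp only: eq x)
  have "integrable (P m x) (\<lambda>y. \<integral>z. indicator A z \<partial>P n y :: real)
      \<longleftrightarrow> integrable (P m x) (\<lambda>y. measure (P n y) A)"
    by (intro Bochner_Integration.integrable_cong refl eq) (simp add: P_props(3)[OF x])
  then show "integrable (P m x) (\<lambda>y. measure (P n y) A)" using I by simp
qed

text \<open>Since \<open>\<nu>\<close> is carried by \<open>C\<close>, the regenerated part of the chain is again in \<open>C\<close>
and can regenerate in each of the following steps.\<close>

lemma pow_minor_C:
  assumes A: "A \<in> sets M" and x: "x \<in> C"
  shows "\<delta> ^ Suc k * measure \<nu> A \<le> measure (P (Suc k) x) A"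
  using x
proof (induction k arbitrary: x)
  case 0
  then show ?case using minor[OF 0 A] kernel_pow_1[OF K C_space[OF 0]] by simp
next
  case (Suc k)
  interpret \<nu>: prob_space \<nu> by (rule \<nu>(1))
  let ?h = "\<lambda>y. measure (P (Suc k) y) A"
  have x: "x \<in> space M" by (rule C_space[OF Suc.prems])
  have P1: "P (Suc 0) x = K x" by (rule kernel_pow_1[OF K x])
  have I: "integrable (K x) ?h" and eq: "measure (P (Suc 0 + Suc k) x) A = (\<integral>y. ?h y \<partial>K x)"
    using measure_pow_add[OF A x, of "Suc 0" "Suc k"] unfolding P1 by auto
  have I\<nu>: "integrable \<nu> ?h"
    using dominated_integral(1)[OF _ \<nu>(1) _ _ _ _ I, of \<delta>] \<delta> minor[OF Suc.prems] prob_kernelD[OF K x] \<nu>(2)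
    by simp
  have "AE y in \<nu>. y \<in> C" using \<nu>.AE_in_set_eq_1[of C] C \<nu> by auto
  then have "AE y in \<nu>. \<delta> ^ Suc k * measure \<nu> A \<le> ?h y"
    by eventually_elim (rule Suc.IH)
  then have "\<delta> ^ Suc k * measure \<nu> A \<le> (\<integral>y. ?h y \<partial>\<nu>)"
    by (rule \<nu>.integral_ge_const[OF I\<nu>])
  then have "\<delta> * (\<delta> ^ Suc k * measure \<nu> A) \<le> \<delta> * (\<integral>y. ?h y \<partial>\<nu>)"
    using \<delta> by (intro mult_left_mono) auto
  also have "\<dots> \<le> (\<integral>y. ?h y \<partial>K x)"
    using dominated_integral(2)[OF _ \<nu>(1) _ _ _ _ I I\<nu>, of \<delta>] \<delta> minor[OF Suc.prems] prob_kernelD[OF K x] \<nu>(2)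
    by simp
  finally show ?case using eq by (simp add: mult.assoc)
qed

text \<open>The induction combines drift and minorization. The lower bound is affine and
decreasing in \<open>V x\<close>. A step from outside \<open>C\<close> multiplies the mean of
\<open>V\<close> by at most \<open>a\<close>, which turns the bound for \<open>m\<close> into the bound for
\<open>m + 1\<close>; a step from inside \<open>C\<close> is covered by the minorization on \<open>C\<close>. Hence
\<open>P m\<close> has a uniform component along \<open>\<nu>\<close> on every sublevel set of \<open>V\<close> whose
level is smaller than \<open>a\<close> to the power \<open>-m\<close>.\<close>

lemma pow_minor:
  assumes A: "A \<in> sets M" and x: "x \<in> space M"
  shows "(1 - a ^ m * V x) * \<delta> ^ m * measure \<nu> A \<le> measure (P m x) A"
  using x
proof (induction m arbitrary: x)
  case 0
  \<comment> \<open>At time \<open>0\<close> the bound is trivial because \<open>V \<ge> 1\<close>.\<close>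
  have "(1 - V x) * measure \<nu> A \<le> 0"
    using V_ge_1[OF 0] by (intro mult_nonpos_nonneg) auto
  then show ?case by (simp only: power_0 mult_1 mult_1_right) (meson measure_nonneg order_trans)
next
  case (Suc m)
  have x: "x \<in> space M" by fact
  show ?case
  proof (cases "x \<in> C")
    case True
    have "(1 - a ^ Suc m * V x) * (\<delta> ^ Suc m * measure \<nu> A) \<le> 1 * (\<delta> ^ Suc m * measure \<nu> A)"
      using \<delta> a V_ge_1[OF x] by (intro mult_right_mono) auto
    then show ?thesis using pow_minor_C[OF A True, of m] by (simp add: mult.assoc)
  next
    case False
    interpret K: prob_space "K x" by (rule prob_kernelD(1)[OF K x])
    have spK: "space (K x) = space M" by (rule prob_kernelD(3)[OF K x])
    have P1: "P (Suc 0) x = K x" by (rule kernel_pow_1[OF K x])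
    have I: "integrable (K x) (\<lambda>y. measure (P m y) A)"
      and eq: "measure (P (Suc 0 + m) x) A = (\<integral>y. measure (P m y) A \<partial>K x)"
      using measure_pow_add[OF A x, of "Suc 0" m] unfolding P1 by auto
    have IV: "integrable (K x) V" using integrable_V_pow[OF x, of "Suc 0"] unfolding P1 .
    have KV: "(\<integral>y. V y \<partial>K x) \<le> a * V x"
    proof -
      have "ennreal (\<integral>y. V y \<partial>K x) = (\<integral>\<^sup>+y. ennreal (V y) \<partial>K x)"
        using IV V_ge_1 by (intro nn_integral_eq_integral[symmetric] AE_I2) (force simp: spK)+
      also have "\<dots> \<le> ennreal (a * V x)" using drift[OF x] False by simp
      finally show ?thesis using a V_ge_1[OF x] by (simp add: ennreal_le_iff)
    qed
    let ?c = "\<delta> ^ m * measure \<nu> A"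
    have c: "0 \<le> ?c" using \<delta> by simp
    show ?thesis
    proof (cases "a ^ Suc m * V x \<le> 1")
      case True
      have "(1 - a ^ Suc m * V x) * (\<delta> ^ Suc m * measure \<nu> A) \<le> (1 - a ^ Suc m * V x) * ?c"
        using True \<delta> c mult_right_mono[of \<delta> 1 ?c] by (intro mult_left_mono) (auto simp: mult.assoc)
      also have "\<dots> \<le> (1 - a ^ m * (\<integral>y. V y \<partial>K x)) * ?c"
        using mult_left_mono[OF KV, of "a ^ m"] a c by (intro mult_right_mono) (auto simp: mult.assoc mult.left_commute)
      also have "\<dots> = (\<integral>y. (1 - a ^ m * V y) * ?c \<partial>K x)"
        using IV by (simp add: K.prob_space)
      also have "\<dots> \<le> (\<integral>y. measure (P m y) A \<partial>K x)"
        using IV I Suc.IH by (intro integral_mono) (auto simp: spK mult.assoc)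
      finally show ?thesis using eq by (simp add: mult.assoc)
    next
      case False
      then have "(1 - a ^ Suc m * V x) * (\<delta> ^ Suc m * measure \<nu> A) \<le> 0"
        using \<delta> by (intro mult_nonpos_nonneg) auto
      then show ?thesis by (simp only: mult.assoc) (meson measure_nonneg order_trans)
    qed
  qed
qed

end

section \<open>Contraction of the weighted oscillation\<close>

text \<open>The block length \<open>m\<close> is taken so large that the level \<open>4 D / (1 - a)\<close>, twice the level at
which the drift of \<open>P m\<close> balances for a pair of points, satisfies
\<open>a ^ m * (4 * D / (1 - a)) \<le> 4 / 7\<close>. On that sublevel set \<open>P m\<close> then has the component
\<open>\<alpha> \<nu>\<close>.\<close>

locale harris_contraction = harris_kernel +
  fixes m :: nat
  assumes m: "0 < m" "7 * a ^ m \<le> (1 - a) / D"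
begin

definition \<alpha> :: real where "\<alpha> = 3 / 7 * \<delta> ^ m"
text \<open>The weight \<open>\<beta>\<close> balances the two effects: the additive term of the drift of \<open>P m\<close>,
counted once for each of two starting points and multiplied by \<open>\<beta>\<close>, costs exactly
\<open>\<alpha>\<close>, half of the gain \<open>2 \<alpha>\<close> from the common component.\<close>

definition \<beta> :: real where "\<beta> = \<alpha> * (1 - a) / (2 * (1 - a ^ m) * D)"
definition contr :: real where "contr = 1 - \<delta> ^ m / 7"

lemma delta_m: "0 < \<delta> ^ m" "\<delta> ^ m \<le> 1"
  using \<delta> by (auto intro: power_le_one)

lemma alpha: "0 < \<alpha>" "\<alpha> \<le> 3 / 7" "contr = 1 - \<alpha> / 3"
  using delta_m by (auto simp: \<alpha>_def contr_def)

lemma contr_bounds: "0 < contr" "contr < 1"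
  using delta_m by (auto simp: contr_def)

lemma a_m: "0 < a ^ m" "a ^ m \<le> 1 / 7" "a ^ m * (4 * D / (1 - a)) \<le> 4 / 7"
proof -
  show "0 < a ^ m" using a by simp
  have "(1 - a) / D \<le> 1" using a D by (simp add: divide_le_eq)
  then show "a ^ m \<le> 1 / 7" using m by simp
  have "a ^ m \<le> (1 - a) / (7 * D)" using m by simp
  then have "a ^ m * (4 * D / (1 - a)) \<le> (1 - a) / (7 * D) * (4 * D / (1 - a))"
    using a D by (intro mult_right_mono) auto
  also have "\<dots> = 4 / 7" using a D by (simp add: divide_simps)
  finally show "a ^ m * (4 * D / (1 - a)) \<le> 4 / 7" .
qed

lemma beta: "0 < \<beta>" "2 * \<beta> * ((1 - a ^ m) * (D / (1 - a))) = \<alpha>"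
proof -
  have ne: "1 - a ^ m > 0" "1 - a > 0" "D > 0" using a_m(2) a D by auto
  then show "0 < \<beta>" using alpha(1) unfolding \<beta>_def by simp
  show "2 * \<beta> * ((1 - a ^ m) * (D / (1 - a))) = \<alpha>"
    using ne unfolding \<beta>_def by (simp add: divide_simps)
qed

lemma two_div_beta: "2 / \<beta> = 4 * ((1 - a ^ m) / \<alpha>) * (D / (1 - a))"
  using alpha a_m a D unfolding \<beta>_def by simp

text \<open>This lets the oscillation of \<open>\<integral>f dP j x\<close> for any \<open>0 \<le> f \<le> V\<close> be bounded by
\<open>1 / \<beta>\<close> times the weight, so that a remainder of fewer than \<open>m\<close> steps costs nothing.\<close>

lemma offset_le: "D / (1 - a) \<le> 2 / \<beta>"
proof -
  have "\<alpha> \<le> 1 - a ^ m" using alpha(2) a_m(2) by simp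
  then have "1 \<le> (1 - a ^ m) / \<alpha>" using alpha(1) by simp
  then have "1 \<le> 4 * ((1 - a ^ m) / \<alpha>)" by linarith
  then show ?thesis unfolding two_div_beta using mult_right_mono[of 1 _ "D / (1 - a)"] a D by force
qed

text \<open>The contraction of Hairer and Mattingly, with the oscillation of \<open>\<phi>\<close> measured relative to
\<open>2 + \<beta> (V u + V w)\<close>. For a pair with large \<open>V x + V y\<close> the drift shrinks the weight
itself; for the other pairs \<open>P m x\<close> and \<open>P m y\<close> share the component \<open>\<alpha> \<nu>\<close>,
which reduces the constant \<open>2\<close>.\<close>

lemma one_step_contraction:
  fixes \<phi> :: "'a \<Rightarrow> real"
  assumes x: "x \<in> space M" and y: "y \<in> space M" and t: "0 \<le> t"
    and meas: "\<phi> \<in> borel_measurable M" and bd: "\<And>z. z \<in> space M \<Longrightarrow> \<bar>\<phi> z\<bar> \<le> c * V z"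
    and osc: "\<And>u w. u \<in> space M \<Longrightarrow> w \<in> space M \<Longrightarrow> \<phi> u - \<phi> w \<le> t * (2 + \<beta> * (V u + V w))"
  shows "(\<integral>z. \<phi> z \<partial>P m x) - (\<integral>z. \<phi> z \<partial>P m y) \<le> contr * t * (2 + \<beta> * (V x + V y))"
proof -
  let ?s = "V x + V y" and ?b = "a ^ m"
  let ?I = "(\<integral>z. V z \<partial>P m x) + (\<integral>z. V z \<partial>P m y)"
  have int: "integrable (P n z) \<phi>" if "z \<in> space M" for n z
    using integrable_pow[OF meas _ that] bd by blast
  have osc': "\<phi> u - \<phi> w \<le> 2 * t + t * \<beta> * (V u + V w)" if "u \<in> space M" "w \<in> space M" for u w
    using osc[OF that] by (simp add: algebra_simps)
  have V0: "0 \<le> V z" if "z \<in> space M" for z using V_ge_1[OF that] by simp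
  have I: "\<beta> * ?I \<le> \<beta> * ?b * ?s + \<alpha>"
  proof -
    define k where "k = (1 - ?b) * (D / (1 - a))"
    have "?I \<le> ?b * ?s + 2 * k"
      using integral_V_pow[OF x, of m, folded k_def] integral_V_pow[OF y, of m, folded k_def]
      by (simp add: distrib_left)
    then have "?I \<le> ?b * ?s + 2 * ((1 - ?b) * (D / (1 - a)))" by (simp only: k_def)
    then have "\<beta> * ?I \<le> \<beta> * (?b * ?s + 2 * ((1 - ?b) * (D / (1 - a))))"
      using beta(1) by (intro mult_left_mono) auto
    also have "\<dots> = \<beta> * ?b * ?s + 2 * \<beta> * ((1 - ?b) * (D / (1 - a)))" by (simp add: algebra_simps)
    finally show ?thesis unfolding beta(2) .
  qed
  have s: "0 \<le> ?s" using V0[OF x] V0[OF y] by simp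
  show ?thesis
  proof (cases "4 * D / (1 - a) \<le> ?s")
    case True
    \<comment> \<open>The drift alone: \<open>\<alpha> = 0\<close>, with \<open>P m x\<close> in the place of \<open>\<nu>\<close>.\<close>
    have "(\<integral>z. \<phi> z \<partial>P m x) - (\<integral>z. \<phi> z \<partial>P m y) \<le> 2 * t * (1 - 0) + t * \<beta> * ?I"
      using P_props[OF x, of m] P_props[OF y, of m] integrable_V_pow[OF x, of m] integrable_V_pow[OF y, of m]
        int[OF x, of m] int[OF y, of m] V0 osc' t beta(1)
      by (intro weighted_oscillation_integral[where \<nu>="P m x"]) auto
    also have "\<dots> = t * (2 + \<beta> * ?I)" by (simp add: algebra_simps)
    also have "\<dots> \<le> t * (2 + \<alpha> + \<beta> * ?b * ?s)" using I t by (intro mult_left_mono) auto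
    also have "\<dots> \<le> t * (contr * (2 + \<beta> * ?s))"
    proof (intro mult_left_mono[OF _ t])
      have "\<beta> * (4 * D / (1 - a)) * (1 - ?b) = 2 * (2 * \<beta> * ((1 - ?b) * (D / (1 - a))))" by simp
      also have "\<dots> = 2 * \<alpha>" unfolding beta(2) ..
      finally have R: "\<beta> * (4 * D / (1 - a)) * (1 - ?b) = 2 * \<alpha>" .
      have "\<alpha> / 3 \<le> (1 - ?b) / 6" using alpha(2) a_m(2) by simp
      then have "5 / 6 * (1 - ?b) \<le> 1 - ?b - \<alpha> / 3" by simp
      then have "\<beta> * (4 * D / (1 - a)) * (5 / 6 * (1 - ?b)) \<le> \<beta> * ?s * (1 - ?b - \<alpha> / 3)"
        using True beta(1) a D a_m s by (intro mult_mono) auto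
      moreover have "\<beta> * (4 * D / (1 - a)) * (5 / 6 * (1 - ?b)) = 5 / 6 * (2 * \<alpha>)"
        unfolding R[symmetric] by (rule mult.left_commute)
      ultimately have "5 / 3 * \<alpha> \<le> \<beta> * ?s * (1 - ?b - \<alpha> / 3)" by simp
      then show "2 + \<alpha> + \<beta> * ?b * ?s \<le> contr * (2 + \<beta> * ?s)"
        unfolding alpha(3) by (simp add: algebra_simps)
    qed
    finally show ?thesis by (simp add: mult.commute mult.left_commute)
  next
    case False
    have minor_x: "\<alpha> * measure \<nu> A \<le> measure (P m x) A"
      if x: "x \<in> space M" and Vx: "V x \<le> 4 * D / (1 - a)" and A: "A \<in> sets M" for x A
    proof -
      have "?b * V x \<le> 4 / 7" using mult_left_mono[OF Vx, of ?b] a_m by linarith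
      then have "3 / 7 * (\<delta> ^ m * measure \<nu> A) \<le> (1 - ?b * V x) * (\<delta> ^ m * measure \<nu> A)"
        using delta_m by (intro mult_right_mono) auto
      also have "\<dots> \<le> measure (P m x) A" using pow_minor[OF A x, of m] by (simp add: mult.assoc)
      finally show ?thesis by (simp add: \<alpha>_def)
    qed
    have Vx: "V x \<le> 4 * D / (1 - a)" and Vy: "V y \<le> 4 * D / (1 - a)"
      using False V0[OF x] V0[OF y] by auto
    note minor_xy = minor_x[OF x Vx] minor_x[OF y Vy]
    have sp\<nu>: "space \<nu> = space M" by (rule sets_eq_imp_space_eq[OF \<nu>(2)])
    have \<nu>_int: "integrable \<nu> f" if f: "f \<in> borel_measurable M" "\<And>z. z \<in> space M \<Longrightarrow> \<bar>f z\<bar> \<le> d * V z"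
      for f :: "'a \<Rightarrow> real" and d
    proof (rule Bochner_Integration.integrable_bound)
      have "integrable \<nu> V"
        using dominated_integral(1)[OF P_props(1)[OF x] \<nu>(1) _ _ _ _ integrable_V_pow[OF x], of m \<alpha>]
          minor_xy(1) alpha(1) V0 P_props(2)[OF x] \<nu>(2) sp\<nu> by simp
      then show "integrable \<nu> (\<lambda>z. d * V z)" by simp
      show "f \<in> borel_measurable \<nu>" using f by (simp add: measurable_cong_sets[OF \<nu>(2) refl])
      show "AE z in \<nu>. norm (f z) \<le> norm (d * V z)"
        using f(2) by (intro AE_I2) (force simp: sp\<nu>)
    qed
    have \<nu>_\<phi>: "integrable \<nu> \<phi>" using \<nu>_int[OF meas] bd by blast
    have \<nu>_V: "integrable \<nu> V" using \<nu>_int[OF V_meas, of 1] V0 by simp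
    have "(\<integral>z. \<phi> z \<partial>P m x) - (\<integral>z. \<phi> z \<partial>P m y) \<le> 2 * t * (1 - \<alpha>) + t * \<beta> * ?I"
      using P_props[OF x, of m] P_props[OF y, of m] integrable_V_pow[OF x, of m] integrable_V_pow[OF y, of m]
        int[OF x, of m] int[OF y, of m] V0 osc' t beta(1) \<nu> sp\<nu> \<nu>_\<phi> \<nu>_V
        alpha minor_xy
      by (intro weighted_oscillation_integral[where \<nu>=\<nu>]) auto
    also have "\<dots> = t * (2 * (1 - \<alpha>) + \<beta> * ?I)" by (simp add: algebra_simps)
    also have "\<dots> \<le> t * (2 - \<alpha> + \<beta> * ?b * ?s)" using I t by (intro mult_left_mono) auto
    also have "\<dots> \<le> t * (contr * (2 + \<beta> * ?s))"
    proof (intro mult_left_mono[OF _ t])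
      have "?b \<le> contr" using a_m(2) alpha by simp
      then have "?b * (\<beta> * ?s) \<le> contr * (\<beta> * ?s)" using beta(1) s by (intro mult_right_mono) auto
      moreover have "2 - \<alpha> \<le> contr * 2" using alpha by simp
      ultimately show "2 - \<alpha> + \<beta> * ?b * ?s \<le> contr * (2 + \<beta> * ?s)" by (simp add: algebra_simps)
    qed
    finally show ?thesis by (simp add: mult.commute mult.left_commute)
  qed
qed

definition decay :: "nat \<Rightarrow> real" where "decay n = contr ^ (n div m)"

lemma decay_nonneg: "0 \<le> decay n" using contr_bounds by (simp add: decay_def)

lemma decay_tendsto_0: "decay \<longlonglongrightarrow> 0"
proof -
  have "filterlim (\<lambda>n. n div m) at_top sequentially"
    unfolding filterlim_at_top eventually_sequentially
    using m(1) by (metis div_le_mono mult.commute nonzero_mult_div_cancel_left not_gr_zero)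
  moreover have "(\<lambda>n. contr ^ n) \<longlonglongrightarrow> 0" using contr_bounds by (intro LIMSEQ_realpow_zero) auto
  ultimately show ?thesis unfolding decay_def[abs_def] by (rule filterlim_compose[rotated])
qed

lemma iterated_contraction:
  fixes \<phi> :: "'a \<Rightarrow> real"
  assumes t: "0 \<le> t" and c: "0 \<le> c"
    and meas: "\<phi> \<in> borel_measurable M" and nonneg: "\<And>z. z \<in> space M \<Longrightarrow> 0 \<le> \<phi> z"
    and bd: "\<And>z. z \<in> space M \<Longrightarrow> \<phi> z \<le> c * V z"
    and osc: "\<And>u w. u \<in> space M \<Longrightarrow> w \<in> space M \<Longrightarrow> \<phi> u - \<phi> w \<le> t * (2 + \<beta> * (V u + V w))"
    and x: "x \<in> space M" and y: "y \<in> space M"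
  shows "(\<integral>z. \<phi> z \<partial>P (k * m) x) - (\<integral>z. \<phi> z \<partial>P (k * m) y) \<le> contr ^ k * t * (2 + \<beta> * (V x + V y))"
  using x y
proof (induction k arbitrary: x y)
  case 0
  then show ?case using osc[OF 0] meas by (simp add: integral_return)
next
  case (Suc k)
  let ?\<psi> = "\<lambda>x. \<integral>z. \<phi> z \<partial>P (k * m) x"
  have add: "(\<integral>z. \<phi> z \<partial>P (Suc k * m) x) = (\<integral>y. ?\<psi> y \<partial>P m x)" if "x \<in> space M" for x
    using integral_pow_add(1)[OF meas nonneg bd that, of m "k * m"] by simp
  have bd': "\<bar>?\<psi> z\<bar> \<le> c * (1 + D / (1 - a)) * V z" if z: "z \<in> space M" for z
  proof -
    have "0 \<le> ?\<psi> z" using nonneg by (intro integral_nonneg_AE AE_I2) (auto simp: P_props(3)[OF z])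
    moreover have "?\<psi> z \<le> (\<integral>w. c * V w \<partial>P (k * m) z)"
      using bd nonneg integrable_V_pow[OF z] z
      by (intro integral_mono integrable_pow[OF meas, where c=c]) (auto simp: P_props(3)[OF z])
    moreover have "(\<integral>w. c * V w \<partial>P (k * m) z) \<le> c * (V z + D / (1 - a))"
      using mult_left_mono[OF integral_V_pow_le[OF z, of "k * m"] c] by simp
    moreover have "c * (V z + D / (1 - a)) \<le> c * ((1 + D / (1 - a)) * V z)"
      using V_ge_1[OF z] a D mult_left_mono[of 1 "V z" "D / (1 - a)"]
      by (intro mult_left_mono c) (simp add: distrib_right)
    ultimately show ?thesis by (simp add: mult.assoc)
  qed
  have "?\<psi> u - ?\<psi> w \<le> contr ^ k * t * (2 + \<beta> * (V u + V w))" if "u \<in> space M" "w \<in> space M" for u w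
    using Suc.IH[OF that] .
  then have "(\<integral>y. ?\<psi> y \<partial>P m x) - (\<integral>y. ?\<psi> y \<partial>P m y) \<le> contr * (contr ^ k * t) * (2 + \<beta> * (V x + V y))"
    using contr_bounds t by (intro one_step_contraction[OF Suc.prems _ integral_pow_measurable[OF meas] bd']) auto
  then show ?case unfolding add[OF Suc.prems(1)] add[OF Suc.prems(2)] by simp
qed

text \<open>A time \<open>n\<close> is split into \<open>n div m\<close> contracting blocks followed by a remainder, which is
absorbed into the test function before the blocks act on it.\<close>

lemma pow_difference_bound:
  fixes f :: "'a \<Rightarrow> real"
  assumes f: "f \<in> borel_measurable M" "\<And>z. z \<in> space M \<Longrightarrow> 0 \<le> f z" "\<And>z. z \<in> space M \<Longrightarrow> f z \<le> V z"
    and x: "x \<in> space M" and y: "y \<in> space M"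
  shows "\<bar>(\<integral>z. f z \<partial>P n x) - (\<integral>z. f z \<partial>P n y)\<bar> \<le> decay n * (2 / \<beta> + V x + V y)"
proof -
  let ?j = "n mod m" and ?k = "n div m"
  let ?\<phi> = "\<lambda>x. \<integral>z. f z \<partial>P ?j x"
  have n: "?k * m + ?j = n" by simp
  have eq: "(\<integral>z. f z \<partial>P n x) = (\<integral>y. ?\<phi> y \<partial>P (?k * m) x)" if "x \<in> space M" for x
    using integral_pow_add(1)[of f 1 x "?k * m" ?j] f that by (simp add: n)
  have osc: "?\<phi> u - ?\<phi> w \<le> 1 / \<beta> * (2 + \<beta> * (V u + V w))" if "u \<in> space M" "w \<in> space M" for u w
  proof -
    have "?\<phi> u \<le> V u + D / (1 - a)" "0 \<le> ?\<phi> w" using integral_pow_bounds[OF f] that by auto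
    moreover have "1 / \<beta> * (2 + \<beta> * (V u + V w)) = 2 / \<beta> + (V u + V w)"
      using beta(1) by (simp add: field_simps)
    ultimately show ?thesis using offset_le V_ge_1[OF that(2)] by linarith
  qed
  have bd: "?\<phi> z \<le> (1 + D / (1 - a)) * V z" if "z \<in> space M" for z
  proof -
    have "D / (1 - a) * 1 \<le> D / (1 - a) * V z" using V_ge_1[OF that] a D by (intro mult_left_mono) auto
    then show ?thesis using integral_pow_bounds(2)[OF f that, of ?j] by (simp add: distrib_right)
  qed
  have *: "(\<integral>z. f z \<partial>P n x) - (\<integral>z. f z \<partial>P n y) \<le> decay n * (2 / \<beta> + V x + V y)"
    if x: "x \<in> space M" and y: "y \<in> space M" for x y
  proof -
    have "(\<integral>z. ?\<phi> z \<partial>P (?k * m) x) - (\<integral>z. ?\<phi> z \<partial>P (?k * m) y)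
        \<le> contr ^ ?k * (1 / \<beta>) * (2 + \<beta> * (V x + V y))"
      using beta(1) a D integral_pow_bounds(1)[OF f] osc bd x y
      by (intro iterated_contraction[where c="1 + D / (1 - a)"] integral_pow_measurable f) auto
    also have "\<dots> = decay n * (2 / \<beta> + V x + V y)"
      using beta(1) by (simp add: decay_def field_simps)
    finally show ?thesis using eq x y by simp
  qed
  show ?thesis using *[OF x y] *[OF y x] by (simp add: abs_le_iff algebra_simps)
qed


section \<open>Invariant distribution and convergence\<close>

text \<open>By Chapman--Kolmogorov the law at time \<open>k + n\<close> is a mixture of the laws at time \<open>n\<close>
started from the points \<open>y\<close> of time \<open>k\<close>, and each of these is close to the law started
at \<open>x\<close>.\<close>

lemma pow_cauchy_bound:
  fixes f :: "'a \<Rightarrow> real"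
  assumes f: "f \<in> borel_measurable M" "\<And>z. z \<in> space M \<Longrightarrow> 0 \<le> f z" "\<And>z. z \<in> space M \<Longrightarrow> f z \<le> V z"
    and x: "x \<in> space M"
  shows "\<bar>(\<integral>z. f z \<partial>P (k + n) x) - (\<integral>z. f z \<partial>P n x)\<bar> \<le> decay n * (2 / \<beta> + 2 * V x + D / (1 - a))"
proof -
  interpret Pk: prob_space "P k x" by (rule P_props(1)[OF x])
  have add: "(\<integral>z. f z \<partial>P (k + n) x) = (\<integral>y. \<integral>z. f z \<partial>P n y \<partial>P k x)"
    and I: "integrable (P k x) (\<lambda>y. \<integral>z. f z \<partial>P n y)"
    using integral_pow_add[of f 1 x k n] f x by auto
  note IV = integrable_V_pow[OF x, of k]
  have "(\<integral>z. f z \<partial>P (k + n) x) - (\<integral>z. f z \<partial>P n x)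
      = (\<integral>y. (\<integral>z. f z \<partial>P n y) - (\<integral>z. f z \<partial>P n x) \<partial>P k x)"
    using I by (simp add: add Pk.prob_space)
  also have "\<bar>\<dots>\<bar> \<le> (\<integral>y. \<bar>(\<integral>z. f z \<partial>P n y) - (\<integral>z. f z \<partial>P n x)\<bar> \<partial>P k x)"
    by (rule integral_abs_bound)
  also have "\<dots> \<le> (\<integral>y. decay n * (2 / \<beta> + V y + V x) \<partial>P k x)"
    using pow_difference_bound[OF f] I IV x
    by (intro integral_mono) (auto simp: P_props(3)[OF x])
  also have "\<dots> = decay n * (2 / \<beta> + (\<integral>y. V y \<partial>P k x) + V x)"
    using IV by (simp add: Pk.prob_space)
  also have "\<dots> \<le> decay n * (2 / \<beta> + 2 * V x + D / (1 - a))"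
    using integral_V_pow_le[OF x, of k] by (intro mult_left_mono decay_nonneg) simp
  finally show ?thesis .
qed

text \<open>The invariant distribution is the setwise limit of the laws started at one point. Fatou's lemma
yields only that it is superinvariant, which is enough: applying this to a set and to its
complement, for two probability measures, forces equality.\<close>

lemma invariant_distribution_exists:
  assumes x: "x \<in> space M"
  obtains \<pi> where "invariant_distribution M K \<pi>" "integrable \<pi> V" "(\<integral>z. V z \<partial>\<pi>) \<le> D / (1 - a)"
proof -
  have ind: "\<bar>measure (P (k + n) x) A - measure (P n x) A\<bar> \<le> decay n * (2 / \<beta> + 2 * V x + D / (1 - a))"
    if A: "A \<in> sets M" for A n k
  proof -
    have eq: "(\<integral>z. indicator A z \<partial>P k x) = measure (P k x) A" for k
      using sets.sets_into_space[OF A] P_props(3)[OF x, of k] by (simp add: Int_absorb1 Int_absorb2)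
    have "(indicator A :: 'a \<Rightarrow> real) \<in> borel_measurable M" "\<And>z. 0 \<le> (indicator A z :: real)"
      "\<And>z. z \<in> space M \<Longrightarrow> indicator A z \<le> V z"
      using A V_ge_1 by (auto simp: indicator_def intro: order_trans[OF zero_le_one])
    from pow_cauchy_bound[OF this x] show ?thesis unfolding eq .
  qed
  have "(\<lambda>n. decay n * (2 / \<beta> + 2 * V x + D / (1 - a))) \<longlonglongrightarrow> 0"
    using tendsto_mult_right[OF decay_tendsto_0] by force
  from setwise_limit_measure[OF P_props(1,2)[OF x] this ind]
  obtain \<pi> where \<pi>: "prob_space \<pi>" "sets \<pi> = sets M"
    and lim: "\<And>A. A \<in> sets M \<Longrightarrow> (\<lambda>n. measure (P n x) A) \<longlonglongrightarrow> measure \<pi> A" by blast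
  interpret \<pi>: prob_space \<pi> by fact
  have sp: "space \<pi> = space M" by (rule sets_eq_imp_space_eq[OF \<pi>(2)])
  note fatou = setwise_limit_nn_integral_le[OF P_props(1)[OF x] \<pi>(1)]
  have K\<pi>: "K \<in> \<pi> \<rightarrow>\<^sub>M subprob_algebra M"
    using measurable_prob_algebraD[OF K] by (simp add: measurable_cong_sets[OF \<pi>(2) refl])
  have sub: "(\<integral>\<^sup>+y. emeasure (K y) A \<partial>\<pi>) \<le> emeasure \<pi> A" if A: "A \<in> sets M" for A
  proof (rule fatou)
    show "sets (P n x) = sets \<pi>" for n using P_props(2)[OF x] \<pi>(2) by simp
    show "(\<lambda>n. measure (P n x) B) \<longlonglongrightarrow> measure \<pi> B" if "B \<in> sets \<pi>" for B
      using lim that \<pi>(2) by simp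
    show "(\<integral>\<^sup>+y. emeasure (K y) A \<partial>P n x) \<le> emeasure (P (Suc n) x) A" for n
    proof -
      have "K \<in> P n x \<rightarrow>\<^sub>M subprob_algebra M"
        using measurable_prob_algebraD[OF K] by (simp add: measurable_cong_sets[OF P_props(2)[OF x] refl])
      then show ?thesis
        using emeasure_bind[OF prob_space.not_empty[OF P_props(1)[OF x, of n]] _ A] by simp
    qed
    show "(\<lambda>n. emeasure (P (Suc n) x) A) \<longlonglongrightarrow> emeasure \<pi> A"
      using tendsto_ennrealI[OF LIMSEQ_Suc[OF lim[OF A]]]
      by (simp add: \<pi>.emeasure_eq_measure
        finite_measure.emeasure_eq_measure[OF prob_space.finite_measure[OF P_props(1)[OF x]]] del: kernel_pow.simps)
  qed
  have inv: "emeasure \<pi> A = (\<integral>\<^sup>+y. emeasure (K y) A \<partial>\<pi>)" if A: "A \<in> sets M" for A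
  proof (rule antisym[OF _ sub[OF A]])
    let ?h = "\<lambda>A y. measure (K y) A"
    have hm: "?h A \<in> borel_measurable \<pi>" if "A \<in> sets M" for A
      using measurable_compose[OF K\<pi> measurable_measure_subprob_algebra[OF that]] .
    have Kp: "prob_space (K y)" "space (K y) = space M" "sets (K y) = sets M" if "y \<in> space \<pi>" for y
      using prob_kernelD[OF K] that sp by auto
    have hI: "integrable \<pi> (?h A)" if "A \<in> sets M" for A
      using hm[OF that] prob_space.prob_le_1[OF Kp(1)]
      by (intro \<pi>.integrable_const_bound[where B=1] AE_I2) auto
    have em: "(\<integral>\<^sup>+y. emeasure (K y) A \<partial>\<pi>) = ennreal (\<integral>y. ?h A y \<partial>\<pi>)" if "A \<in> sets M" for A
    proof -
      have "(\<integral>\<^sup>+y. emeasure (K y) A \<partial>\<pi>) = (\<integral>\<^sup>+y. ennreal (?h A y) \<partial>\<pi>)"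
        by (intro nn_integral_cong finite_measure.emeasure_eq_measure prob_space.finite_measure Kp(1))
      also have "\<dots> = ennreal (\<integral>y. ?h A y \<partial>\<pi>)"
        using hI[OF that] by (intro nn_integral_eq_integral) auto
      finally show ?thesis .
    qed
    have A': "space M - A \<in> sets M" using A by auto
    have "(\<integral>y. ?h (space M - A) y \<partial>\<pi>) = (\<integral>y. 1 - ?h A y \<partial>\<pi>)"
      using A Kp prob_space.prob_compl by (intro Bochner_Integration.integral_cong) fastforce+
    also have "\<dots> = 1 - (\<integral>y. ?h A y \<partial>\<pi>)" using hI[OF A] by (simp add: \<pi>.prob_space)
    finally have c: "(\<integral>y. ?h (space M - A) y \<partial>\<pi>) = 1 - (\<integral>y. ?h A y \<partial>\<pi>)" .
    have "(\<integral>y. ?h (space M - A) y \<partial>\<pi>) \<le> measure \<pi> (space M - A)"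
      using sub[OF A'] unfolding em[OF A'] by (simp add: \<pi>.emeasure_eq_measure)
    moreover have "measure \<pi> (space M - A) = 1 - measure \<pi> A"
      using \<pi>.prob_compl[of A] A \<pi>(2) sp by simp
    ultimately show "emeasure \<pi> A \<le> (\<integral>\<^sup>+y. emeasure (K y) A \<partial>\<pi>)"
      unfolding em[OF A] c by (simp add: \<pi>.emeasure_eq_measure ennreal_leI)
  qed
  have VI: "(\<integral>\<^sup>+z. ennreal (V z) \<partial>\<pi>) \<le> ennreal (D / (1 - a))"
  proof (rule fatou)
    show "sets (P n x) = sets \<pi>" for n using P_props(2)[OF x] \<pi>(2) by simp
    show "(\<lambda>n. measure (P n x) B) \<longlonglongrightarrow> measure \<pi> B" if "B \<in> sets \<pi>" for B
      using lim that \<pi>(2) by simp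
    show "(\<integral>\<^sup>+z. ennreal (V z) \<partial>P n x) \<le> ennreal (a ^ n * V x + (1 - a ^ n) * (D / (1 - a)))" for n
      by (rule nn_integral_V_pow[OF x])
    have "(\<lambda>n. a ^ n * V x + (1 - a ^ n) * (D / (1 - a))) \<longlonglongrightarrow> 0 * V x + (1 - 0) * (D / (1 - a))"
      by (intro tendsto_intros) (use a in auto)
    then show "(\<lambda>n. ennreal (a ^ n * V x + (1 - a ^ n) * (D / (1 - a)))) \<longlonglongrightarrow> ennreal (D / (1 - a))"
      by (intro tendsto_ennrealI) simp
  qed
  have V\<pi>: "AE z in \<pi>. 0 \<le> V z" using V_ge_1 by (intro AE_I2) (force simp: sp)
  have Vint: "integrable \<pi> V"
    using VI V\<pi> by (intro integrableI_nonneg) (auto simp: measurable_cong_sets[OF \<pi>(2) refl] intro: le_less_trans)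
  show thesis
  proof
    show "invariant_distribution M K \<pi>" unfolding invariant_distribution_def using \<pi> inv by blast
    show "integrable \<pi> V" by fact
    show "(\<integral>z. V z \<partial>\<pi>) \<le> D / (1 - a)"
      using VI nn_integral_eq_integral[OF Vint V\<pi>] a D by (simp add: ennreal_le_iff)
  qed
qed

text \<open>Invariance writes the integral of \<open>f\<close> against \<open>\<pi>\<close> as the \<open>\<pi>\<close>-mean of its values after
\<open>n\<close> steps, so the bound for pairs of starting points is averaged over the second point.\<close>

lemma geometric_ergodicity:
  fixes f :: "'a \<Rightarrow> real"
  assumes inv: "invariant_distribution M K \<pi>" and V\<pi>: "integrable \<pi> V" "(\<integral>z. V z \<partial>\<pi>) \<le> D / (1 - a)"
    and f: "f \<in> borel_measurable M" "\<And>z. z \<in> space M \<Longrightarrow> 0 \<le> f z" "\<And>z. z \<in> space M \<Longrightarrow> f z \<le> V z"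
    and x: "x \<in> space M"
  shows "\<bar>(\<integral>z. f z \<partial>P n x) - (\<integral>z. f z \<partial>\<pi>)\<bar> \<le> decay n * (2 / \<beta> + V x + D / (1 - a))"
proof -
  have \<pi>: "prob_space \<pi>" "sets \<pi> = sets M" using inv by (auto simp: invariant_distribution_def)
  interpret \<pi>: prob_space \<pi> by fact
  have sp: "space \<pi> = space M" by (rule sets_eq_imp_space_eq[OF \<pi>(2)])
  have sub: "Q \<in> \<pi> \<rightarrow>\<^sub>M subprob_algebra M" if "Q \<in> M \<rightarrow>\<^sub>M prob_algebra M" for Q
    using measurable_prob_algebraD[OF that] by (simp add: measurable_cong_sets[OF \<pi>(2) refl])
  have bindK: "\<pi> \<bind> K = \<pi>"
  proof (rule measure_eqI)
    show s: "sets (\<pi> \<bind> K) = sets \<pi>"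
      using sets_bind'[OF _ K, of \<pi>] \<pi> by (simp add: space_prob_algebra)
    show "emeasure (\<pi> \<bind> K) A = emeasure \<pi> A" if "A \<in> sets (\<pi> \<bind> K)" for A
      using that inv \<pi>(2) emeasure_bind[OF \<pi>.not_empty sub[OF K], of A] s
      by (simp add: invariant_distribution_def)
  qed
  have bind: "\<pi> \<bind> P n = \<pi>"
  proof (induction n)
    case 0
    show ?case using \<pi>(2) by (simp add: bind_return'')
  next
    case (Suc n)
    then show ?case
      using bind_assoc[OF sub[OF P_kernel] measurable_prob_algebraD[OF K], of n] bindK by simp
  qed
  have f\<pi>: "integrable \<pi> f"
  proof (rule Bochner_Integration.integrable_bound[OF V\<pi>(1)])
    show "f \<in> borel_measurable \<pi>" using f(1) by (simp add: measurable_cong_sets[OF \<pi>(2) refl])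
    show "AE z in \<pi>. norm (f z) \<le> norm (V z)" using f(2,3) by (intro AE_I2) (force simp: sp)
  qed
  have If: "integrable (P n y) f" if "y \<in> space M" for y
    using f that by (intro integrable_pow[where c=1]) auto
  have I: "integrable \<pi> (\<lambda>y. \<integral>z. f z \<partial>P n y)"
    and eq: "(\<integral>z. f z \<partial>\<pi>) = (\<integral>y. \<integral>z. f z \<partial>P n y \<partial>\<pi>)"
    using integral_bind_nonneg[OF P_kernel \<pi>(2) f(1,2) If] f\<pi> unfolding bind by auto
  have "(\<integral>z. f z \<partial>P n x) - (\<integral>z. f z \<partial>\<pi>) = (\<integral>y. (\<integral>z. f z \<partial>P n x) - (\<integral>z. f z \<partial>P n y) \<partial>\<pi>)"
    using I by (simp add: eq \<pi>.prob_space)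
  also have "\<bar>\<dots>\<bar> \<le> (\<integral>y. \<bar>(\<integral>z. f z \<partial>P n x) - (\<integral>z. f z \<partial>P n y)\<bar> \<partial>\<pi>)"
    by (rule integral_abs_bound)
  also have "\<dots> \<le> (\<integral>y. decay n * (2 / \<beta> + V x + V y) \<partial>\<pi>)"
    using pow_difference_bound[OF f x] I V\<pi> by (intro integral_mono) (auto simp: sp)
  also have "\<dots> = decay n * (2 / \<beta> + V x + (\<integral>y. V y \<partial>\<pi>))"
    using V\<pi> by (simp add: \<pi>.prob_space)
  also have "\<dots> \<le> decay n * (2 / \<beta> + V x + D / (1 - a))"
    using V\<pi>(2) by (intro mult_left_mono decay_nonneg) simp
  finally show ?thesis .
qed

end

text \<open>Passing from whole blocks to single steps loses at most one block, that is a factor below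
\<open>2\<close>. The constant
\<open>2 / \<beta> + V x + D / (1 - a)\<close> is at most \<open>12 * (D / (1 - a)) / \<delta> ^ m * V x\<close>, and
\<open>8 * \<kappa> \<le> \<delta> ^ m\<close> turns the power of \<open>\<delta>\<close> into \<open>1 / \<kappa>\<close>.\<close>

lemma (in harris_contraction) rate_to_exponential:
  assumes \<kappa>: "0 < \<kappa>" "\<kappa> \<le> \<delta> ^ m / (8 * real m)" and x: "x \<in> space M"
  shows "decay n * (2 / \<beta> + V x + D / (1 - a)) \<le> V x * (3 * (D / (1 - a)) / \<kappa> * exp (- \<kappa> * real n))"
proof -
  let ?k = "n div m" and ?b = "D / (1 - a)" and ?d = "\<delta> ^ m"
  have b: "1 \<le> ?b" using a D by simp
  have mpos: "0 < real m" "1 \<le> real m" using m(1) by auto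
  have "n < m * (?k + 1)" using m(1) by (simp add: dividend_less_times_div)
  then have "real n \<le> real m * (real ?k + 1)" by (metis less_imp_le of_nat_1 of_nat_add of_nat_le_iff of_nat_mult)
  then have "\<kappa> * real n \<le> ?d / (8 * real m) * (real m * (real ?k + 1))"
    using \<kappa> by (intro mult_mono) auto
  also have "\<dots> = ?d / 8 * (real ?k + 1)" using mpos by simp
  also have "\<dots> \<le> ?d / 7 * real ?k + 1 / 2"
  proof -
    have "0 \<le> ?d * real ?k" using delta_m by simp
    then show ?thesis using delta_m(2) by (simp add: field_simps)
  qed
  finally have n: "\<kappa> * real n - 1 / 2 \<le> real ?k * (?d / 7)" by (simp add: mult.commute)
  have "contr \<le> exp (- (?d / 7))" using exp_ge_add_one_self[of "- (?d / 7)"] by (simp add: contr_def)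
  then have "decay n \<le> exp (- (?d / 7)) ^ ?k" unfolding decay_def using contr_bounds by (intro power_mono) auto
  also have "\<dots> = exp (- (real ?k * (?d / 7)))" by (simp add: exp_of_nat_mult[symmetric])
  also have "\<dots> \<le> exp (1 / 2 + - (\<kappa> * real n))" using n by simp
  also have "\<dots> \<le> 2 * exp (- (\<kappa> * real n))"
  proof -
    have "exp (1 / 2 :: real) \<le> 1 + 1 / 2 + (1 / 2)\<^sup>2" by (rule exp_bound) auto
    then have "exp (1 / 2 :: real) \<le> 2" by (simp add: power2_eq_square)
    then show ?thesis unfolding exp_add by (rule mult_right_mono) simp
  qed
  finally have en: "decay n \<le> 2 * exp (- (\<kappa> * real n))" .
  have C0: "2 / \<beta> + V x + ?b \<le> 12 * (?b / ?d) * V x"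
  proof -
    have "(1 - a ^ m) / \<alpha> \<le> 1 / \<alpha>" using a_m alpha by (intro divide_right_mono) auto
    then have "2 / \<beta> \<le> 4 * (1 / \<alpha>) * ?b" unfolding two_div_beta using b by (intro mult_right_mono mult_left_mono) auto
    also have "\<dots> = 28 / 3 * (?b / ?d)" by (simp add: \<alpha>_def)
    finally have 1: "2 / \<beta> \<le> 28 / 3 * (?b / ?d)" .
    have "?b / 1 \<le> ?b / ?d" using delta_m b by (intro divide_left_mono) auto
    then have 2: "?b \<le> ?b / ?d" by simp
    have "p + t + c \<le> 12 * w * t" if "p \<le> 28 / 3 * w" "c \<le> w" "1 \<le> c" "1 \<le> t" for p c w t :: real
    proof -
      have "11 * w * 1 \<le> 11 * w * t" using that by (intro mult_left_mono) auto
      moreover have "1 * t \<le> w * t" using that by (intro mult_right_mono) auto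
      ultimately show ?thesis using that by linarith
    qed
    from this[OF 1 2 b V_ge_1[OF x]] show ?thesis .
  qed
  have pos: "0 \<le> 2 / \<beta> + V x + ?b" using beta V_ge_1[OF x] b by (intro add_nonneg_nonneg) auto
  have "8 * \<kappa> \<le> ?d / real m" using \<kappa>(2) by (simp add: field_simps)
  also have "\<dots> \<le> ?d / 1" using mpos delta_m by (intro divide_left_mono) auto
  finally have "8 * \<kappa> \<le> ?d" by simp
  have "24 * (c / t) \<le> 3 * c / k" if "8 * k \<le> t" "0 < k" "0 \<le> c" for c k t :: real
  proof -
    have "24 * c / t \<le> 24 * c / (8 * k)" using that by (intro divide_left_mono) auto
    then show ?thesis by simp
  qed
  from this[OF \<open>8 * \<kappa> \<le> ?d\<close> \<kappa>(1), of ?b] have C1: "24 * (?b / ?d) \<le> 3 * ?b / \<kappa>" using b by simp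
  have "decay n * (2 / \<beta> + V x + ?b) \<le> (2 * exp (- (\<kappa> * real n))) * (12 * (?b / ?d) * V x)"
    using en C0 decay_nonneg pos by (intro mult_mono) auto
  also have "\<dots> = V x * (24 * (?b / ?d) * exp (- (\<kappa> * real n)))" by simp
  also have "\<dots> \<le> V x * (3 * ?b / \<kappa> * exp (- (\<kappa> * real n)))"
    using C1 V_ge_1[OF x] by (intro mult_left_mono mult_right_mono) auto
  finally show ?thesis by simp
qed

section \<open>Size of the explicit constants\<close>

text \<open>The large quantities enter through their logarithms:
\<open>G\<close> for \<open>U v\<close>, \<open>T\<close> for \<open>v B\<close>, and \<open>\<Lambda>\<close>, \<open>L\<close> for the
reciprocals of \<open>1 - \<rho>\<close> and \<open>1 - \<delta> * eta1\<close>.\<close>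

locale rate_parameters =
  fixes \<gamma> \<rho> \<delta> D \<eta> v :: real
  assumes \<gamma>: "0 < \<gamma>" "\<gamma> < 1" and \<rho>: "0 < \<rho>" "\<rho> < 1" and \<delta>: "0 < \<delta>" "\<delta> < 1"
    and D: "1 \<le> D" and \<eta>: "0 < \<eta>" "\<eta> \<le> 1 - \<delta>" and v: "1 \<le> v"
begin

abbreviation U where "U \<equiv> U_star \<gamma> \<rho> \<delta> D v"
abbreviation B where "B \<equiv> B_star \<gamma> \<rho> \<delta> D \<eta> v"
abbreviation r where "r \<equiv> r_star \<gamma> \<rho> \<delta> D \<eta> v"
abbreviation q where "q \<equiv> q_tilde \<gamma> \<rho> \<delta> D \<eta> v"
abbreviation l where "l \<equiv> l_tilde \<gamma> \<rho> \<delta> D \<eta> v"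
abbreviation A where "A \<equiv> A_tilde \<gamma> \<rho> \<delta> D \<eta> v"
abbreviation \<epsilon> where "\<epsilon> \<equiv> epsilon_tilde \<gamma> \<rho> \<delta> D \<eta> v"
abbreviation \<rho>\<^sub>1 where "\<rho>\<^sub>1 \<equiv> rho1_tilde \<gamma> \<rho> \<delta> D \<eta> v"
abbreviation \<kappa> where "\<kappa> \<equiv> kappa_star \<gamma> \<rho> \<delta> D \<eta> v"
abbreviation R where "R \<equiv> R_star \<gamma> \<rho> \<delta> D \<eta> v"

definition s where "s = 1 - \<gamma>"
definition x where "x = \<delta> * eta1 \<delta> \<eta>"
definition L where "L = - ln (1 - x)"
definition \<Lambda> where "\<Lambda> = - ln (1 - \<rho>)"
definition G where "G = ln (U * v)"
definition T where "T = ln (v * B)"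
text \<open>Up to the additive constant, \<open>H / \<Lambda>\<close> is the time after which the drift has brought
\<open>(1 - \<rho>) ^ m\<close> down to \<open>\<rho> / D\<close>; it governs the block length of the contraction.\<close>

definition H where "H = 2 + ln (D / \<rho>)"

lemma s_bounds: "0 < s" "s < 1" "\<gamma> = 1 - s"
  using \<gamma> by (auto simp: s_def)

lemma x_bounds: "0 < x" "x \<le> \<delta>" "x < 1"
proof -
  have "0 < eta1 \<delta> \<eta>" "eta1 \<delta> \<eta> \<le> 1" using \<eta> \<delta> by (auto simp: eta1_def)
  then show "0 < x" "x \<le> \<delta>" using \<delta> mult_left_mono[of "eta1 \<delta> \<eta>" 1 \<delta>] by (auto simp: x_def)
  then show "x < 1" using \<delta> by simp
qed

lemma L_bounds: "0 < L" "L \<le> - ln (1 - \<delta>)" "\<bar>ln (1 - x)\<bar> = L"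
  using x_bounds \<delta> by (auto simp: L_def)

lemma Lambda_pos: "0 < \<Lambda>" "\<bar>ln (1 - \<rho>)\<bar> = \<Lambda>" "1 - \<rho> = exp (- \<Lambda>)"
  using \<rho> by (auto simp: \<Lambda>_def)

text \<open>The upper bound is the weighted inequality of arithmetic and geometric means for
\<open>1 - \<rho>\<close> and \<open>1\<close>. It gains the factor \<open>\<gamma>\<close>, which makes \<open>U\<close> large when
\<open>\<gamma>\<close> is small.\<close>

lemma power_gap: "0 < (1 - \<rho>) powr (1 - \<gamma>) * (1 - (1 - \<rho>) powr \<gamma>)"
  "(1 - \<rho>) powr (1 - \<gamma>) * (1 - (1 - \<rho>) powr \<gamma>) \<le> \<gamma> * \<rho>"
proof -
  have "(1 - \<rho>) powr \<gamma> < 1" using \<rho> \<gamma> powr_less_mono2[of \<gamma> "1 - \<rho>" 1] by simp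
  then show "0 < (1 - \<rho>) powr (1 - \<gamma>) * (1 - (1 - \<rho>) powr \<gamma>)" using \<rho> by simp
  have "exp ((1 - \<gamma>) * ln (1 - \<rho>) + \<gamma> * 0) \<le> (1 - \<gamma>) * exp (ln (1 - \<rho>)) + \<gamma> * exp 0"
    using convex_onD[OF exp_convex, of \<gamma> "ln (1 - \<rho>)" 0] \<gamma> by simp
  then have "(1 - \<rho>) powr (1 - \<gamma>) \<le> (1 - \<gamma>) * (1 - \<rho>) + \<gamma>"
    using \<rho> by (simp add: powr_def)
  moreover have "(1 - \<rho>) powr (1 - \<gamma>) * (1 - \<rho>) powr \<gamma> = 1 - \<rho>"
    using \<rho> by (simp add: powr_add[symmetric])
  ultimately show "(1 - \<rho>) powr (1 - \<gamma>) * (1 - (1 - \<rho>) powr \<gamma>) \<le> \<gamma> * \<rho>"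
    by (simp add: algebra_simps)
qed

lemma U_ge: "D / ((1 - \<delta>) * (\<gamma> * \<rho>)) \<le> U" "v / (1 - \<rho>) powr (1 - \<gamma>) \<le> U" "1 \<le> U" "D / \<rho> \<le> U"
proof -
  have p: "0 < (1 - \<delta>) * ((1 - \<rho>) powr (1 - \<gamma>) * (1 - (1 - \<rho>) powr \<gamma>))"
    using \<delta> by (intro mult_pos_pos[OF _ power_gap(1)]) simp
  have "D / ((1 - \<delta>) * (\<gamma> * \<rho>))
      \<le> (1 - \<rho> + D) / ((1 - \<delta>) * ((1 - \<rho>) powr (1 - \<gamma>) * (1 - (1 - \<rho>) powr \<gamma>)))"
    using power_gap(2) \<delta> D \<rho> by (intro frac_le mult_left_mono p) auto
  also have "\<dots> \<le> U" by (simp add: U_star_def mult.assoc)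
  finally show 1: "D / ((1 - \<delta>) * (\<gamma> * \<rho>)) \<le> U" .
  show "v / (1 - \<rho>) powr (1 - \<gamma>) \<le> U" by (simp add: U_star_def)
  have "(1 - \<delta>) * \<gamma> \<le> 1 * 1" using \<delta> \<gamma> by (intro mult_mono) auto
  then have "(1 - \<delta>) * \<gamma> * \<rho> \<le> 1 * \<rho>" using \<rho> by (intro mult_right_mono) auto
  then have "(1 - \<delta>) * (\<gamma> * \<rho>) \<le> \<rho>" by (simp add: mult.assoc)
  then have "D / \<rho> \<le> D / ((1 - \<delta>) * (\<gamma> * \<rho>))" using D \<rho> \<delta> \<gamma> by (intro divide_left_mono) auto
  then show "D / \<rho> \<le> U" using 1 by simp
  moreover have "1 \<le> D / \<rho>" using D \<rho> by simp
  ultimately show "1 \<le> U" by simp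
qed

lemma D_div_rho: "1 \<le> D / \<rho>" "0 \<le> ln (D / \<rho>)"
proof -
  show "1 \<le> D / \<rho>" using D \<rho> by simp
  then show "0 \<le> ln (D / \<rho>)" by (rule ln_ge_zero)
qed

lemma H_ge: "2 \<le> H" using D_div_rho by (simp add: H_def)

lemma exp_G: "exp G = U * v" using U_ge v by (simp add: G_def)

lemma
  shows G_ge_drift: "ln (D / \<rho>) - ln \<gamma> \<le> G"
    and G_ge_minor: "- ln (1 - \<delta>) \<le> G"
    and G_ge_\<Lambda>: "s * \<Lambda> \<le> G"
proof -
  have "U * 1 \<le> U * v" using U_ge v by (intro mult_left_mono) auto
  then have Uv: "U \<le> exp G" by (simp add: exp_G)
  have pos: "0 < D / ((1 - \<delta>) * (\<gamma> * \<rho>))" using D \<delta> \<gamma> \<rho> by simp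
  have "D / ((1 - \<delta>) * (\<gamma> * \<rho>)) \<le> exp G" using U_ge(1) Uv by simp
  then have "ln (D / ((1 - \<delta>) * (\<gamma> * \<rho>))) \<le> G"
    by (subst ln_exp[symmetric], subst ln_le_cancel_iff) (use pos in auto)
  moreover have "ln (D / ((1 - \<delta>) * (\<gamma> * \<rho>))) = ln (D / \<rho>) - ln \<gamma> - ln (1 - \<delta>)"
    using D \<delta> \<gamma> \<rho> by (simp add: ln_div ln_mult)
  moreover have "ln \<gamma> \<le> 0" "ln (1 - \<delta>) \<le> 0" using \<gamma> \<delta> by auto
  ultimately show "ln (D / \<rho>) - ln \<gamma> \<le> G" "- ln (1 - \<delta>) \<le> G" using D_div_rho(2) by linarith+
  have "exp (s * \<Lambda>) = 1 / (1 - \<rho>) powr (1 - \<gamma>)"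
    using \<rho> by (simp add: powr_def s_def \<Lambda>_def exp_minus inverse_eq_divide[symmetric])
  also have "\<dots> \<le> v / (1 - \<rho>) powr (1 - \<gamma>)" using v by (intro divide_right_mono) auto
  also have "\<dots> \<le> exp G" using U_ge(2) Uv by simp
  finally show "s * \<Lambda> \<le> G" by simp
qed

lemma G_pos: "0 < G"
  using G_ge_\<Lambda> mult_pos_pos[OF s_bounds(1) Lambda_pos(1)] by linarith

text \<open>The derivative of \<open>ln t + 2 (1 - t)\<^sup>2\<close> is the perfect square \<open>(1 - 2 t)\<^sup>2\<close> divided by
\<open>t\<close>.\<close>

lemma ln_le_minus_square: "ln \<gamma> \<le> - 2 * s\<^sup>2"
proof -
  have "ln \<gamma> + 2 * (1 - \<gamma>)\<^sup>2 \<le> ln 1 + 2 * (1 - 1)\<^sup>2"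
  proof (rule DERIV_nonneg_imp_nondecreasing[of \<gamma> 1 "\<lambda>t. ln t + 2 * (1 - t)\<^sup>2"])
    show "\<gamma> \<le> 1" using \<gamma> by simp
    fix t :: real assume t: "\<gamma> \<le> t" "t \<le> 1"
    have "((\<lambda>t. ln t + 2 * (1 - t)\<^sup>2) has_real_derivative (1 - 2 * t)\<^sup>2 / t) (at t)"
      using t \<gamma> by (auto intro!: derivative_eq_intros simp: field_simps power2_eq_square)
    then show "\<exists>y. ((\<lambda>t. ln t + 2 * (1 - t)\<^sup>2) has_real_derivative y) (at t) \<and> 0 \<le> y"
      using t \<gamma> by (intro exI[of _ "(1 - 2 * t)\<^sup>2 / t"]) auto
  qed
  then show ?thesis by (simp add: s_def)
qed

text \<open>The factor \<open>s\<^sup>2\<close> is the one that \<open>r\<close> carries, so this inequality lets \<open>r\<close> be compared with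
the block length for every \<open>\<gamma>\<close>: what is lost for \<open>\<gamma>\<close> near \<open>0\<close> is returned by the
summand \<open>- ln \<gamma>\<close> in the lower bound for \<open>G\<close>.\<close>

lemma G_ge_H: "s\<^sup>2 * H \<le> G"
proof -
  have "s\<^sup>2 \<le> 1" using s_bounds by (simp add: power_le_one)
  then have "s\<^sup>2 * ln (D / \<rho>) \<le> 1 * ln (D / \<rho>)" using D_div_rho(2) by (intro mult_right_mono) auto
  then show ?thesis using G_ge_drift ln_le_minus_square by (simp add: H_def distrib_left)
qed

lemma powr_gap: "0 < 1 - (1 - x) powr \<gamma>" "1 - (1 - x) powr \<gamma> \<le> x"
proof -
  show "0 < 1 - (1 - x) powr \<gamma>" using x_bounds \<gamma> powr_less_mono2[of \<gamma> "1 - x" 1] by simp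
  have "(1 - x) powr 1 \<le> (1 - x) powr \<gamma>" using x_bounds \<gamma> by (intro powr_mono') auto
  then show "1 - (1 - x) powr \<gamma> \<le> x" using x_bounds by simp
qed

lemma vB_ge: "exp G * (1 + exp G / x) \<le> v * B" "U \<le> B" "1 \<le> B"
proof -
  have B: "B = U * (1 + U * v / (1 - (1 - x) powr \<gamma>))" by (simp add: B_star_def x_def)
  have "exp G / x \<le> exp G / (1 - (1 - x) powr \<gamma>)" using powr_gap by (intro divide_left_mono) auto
  then have "exp G * (1 + exp G / x) \<le> exp G * (1 + exp G / (1 - (1 - x) powr \<gamma>))"
    by (intro mult_left_mono) auto
  also have "\<dots> = v * B" by (simp add: B exp_G)
  finally show "exp G * (1 + exp G / x) \<le> v * B" .
  have "0 \<le> U * v / (1 - (1 - x) powr \<gamma>)" using U_ge v powr_gap by simp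
  then have "U * 1 \<le> U * (1 + U * v / (1 - (1 - x) powr \<gamma>))" using U_ge by (intro mult_left_mono) auto
  then show "U \<le> B" by (simp add: B)
  then show "1 \<le> B" using U_ge by simp
qed

lemma
  shows T_ge_x: "2 * G - ln x \<le> T" and T_ge_ln2: "G + ln 2 \<le> T"
proof -
  have pos: "0 < v * B" using v vB_ge(3) by (intro mult_pos_pos) auto
  have *: "G + ln y \<le> T" if "0 < y" "y \<le> 1 + exp G / x" for y
  proof -
    have "exp G * y \<le> exp G * (1 + exp G / x)" using that by (intro mult_left_mono) auto
    then have "exp G * y \<le> v * B" using vB_ge(1) by (rule order_trans)
    then have "ln (exp G * y) \<le> T" unfolding T_def using that pos by (subst ln_le_cancel_iff) auto
    then show ?thesis using that by (simp add: ln_mult)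
  qed
  have "ln (exp G / x) = G - ln x" using x_bounds by (simp add: ln_div)
  then show "2 * G - ln x \<le> T" using *[of "exp G / x"] x_bounds by simp
  have "1 \<le> exp G" using G_pos by simp
  then have "x \<le> exp G" using x_bounds by linarith
  then have "1 \<le> exp G / x" using x_bounds by simp
  then show "G + ln 2 \<le> T" using *[of 2] by simp
qed

lemma ln2_bounds: "1 / 2 \<le> ln (2::real)" "ln (2::real) \<le> 1"
proof -
  have "ln (1 / 2) \<le> 1 / 2 - (1::real)" by (rule ln_le_minus_one) simp
  then show "1 / 2 \<le> ln (2::real)" by (simp add: ln_div)
  show "ln (2::real) \<le> 1" using ln_le_minus_one[of "2::real"] by simp
qed

lemma T_pos: "0 < T" using T_ge_ln2 G_pos ln2_bounds by linarith

lemma exp_T: "exp T = v * B"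
  using v vB_ge(3) by (simp add: T_def)

lemma r_eq: "r = s\<^sup>2 * \<Lambda> * L / (G + L)"
  by (simp add: r_star_def s_def Lambda_pos(2) L_bounds(3)[unfolded x_def] G_def)

lemma r_bounds: "0 < r" "r \<le> s\<^sup>2 * \<Lambda> / 2"
proof -
  show "0 < r" using s_bounds Lambda_pos L_bounds G_pos by (simp add: r_eq)
  have "L \<le> G" using L_bounds(2) G_ge_minor by simp
  then have "2 * L \<le> G + L" by simp
  then have "L / (G + L) \<le> 1 / 2" using L_bounds G_pos by (simp add: field_simps)
  then have "s\<^sup>2 * \<Lambda> * (L / (G + L)) \<le> s\<^sup>2 * \<Lambda> * (1 / 2)" using s_bounds Lambda_pos by (intro mult_left_mono) auto
  then show "r \<le> s\<^sup>2 * \<Lambda> / 2" by (simp add: r_eq)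
qed

lemma q_bounds: "(1 - exp (- r)) / 2 \<le> q" "0 < q" "q < 1 / 2"
proof -
  have b: "B1_star \<gamma> \<rho> \<delta> D \<eta> v = min (exp (- r)) (\<delta> / (exp r - 1 + x))"
    by (simp add: B1_star_def x_def)
  have "0 < B1_star \<gamma> \<rho> \<delta> D \<eta> v" unfolding b using r_bounds x_bounds \<delta> by (simp add: add_pos_pos)
  then show "q < 1 / 2" by (simp add: q_tilde_def)
  have "B1_star \<gamma> \<rho> \<delta> D \<eta> v \<le> exp (- r)" unfolding b by simp
  then show 1: "(1 - exp (- r)) / 2 \<le> q" by (simp add: q_tilde_def)
  have "0 < (1 - exp (- r)) / 2" using r_bounds by simp
  then show "0 < q" using 1 by (rule less_le_trans)
qed

text \<open>The number whose integer part enters \<open>l\<close>.\<close>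

definition X where "X = T / r + ln (q * inverse (1 - exp (- r))) / (2 * r)"

lemma l_eq: "l = 2 + \<lfloor>X\<rfloor>"
  by (simp add: l_tilde_def X_def T_def)

lemma X_ge: "(T - ln 2 / 2) / r \<le> X"
proof -
  have e: "0 < 1 - exp (- r)" using r_bounds by simp
  have "1 / 2 \<le> q * inverse (1 - exp (- r))"
    using q_bounds(1) e by (simp add: divide_inverse[symmetric] field_simps)
  then have "ln (1 / 2) \<le> ln (q * inverse (1 - exp (- r)))" by (intro ln_mono) auto
  then have "- ln 2 / (2 * r) \<le> ln (q * inverse (1 - exp (- r))) / (2 * r)"
    using r_bounds by (intro divide_right_mono) (auto simp: ln_div)
  then show ?thesis by (simp add: X_def diff_divide_distrib)
qed

lemma X_ge_2: "2 \<le> X"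
proof -
  have "s * (s * \<Lambda>) \<le> 1 * G" using G_ge_\<Lambda> s_bounds Lambda_pos by (intro mult_mono) auto
  then have "2 * r \<le> G" using r_bounds(2) by (simp add: power2_eq_square mult.assoc)
  also have "G \<le> T - ln 2 / 2" using T_ge_ln2 ln2_bounds by simp
  finally have "2 \<le> (T - ln 2 / 2) / r" using r_bounds by (simp add: field_simps)
  then show ?thesis using X_ge by simp
qed

lemma \<epsilon>_eq: "\<epsilon> = x * (1 - \<delta>) ^ nat \<lfloor>X\<rfloor>"
proof -
  have "0 \<le> \<lfloor>X\<rfloor>" using X_ge_2 by simp
  then show ?thesis by (simp add: epsilon_tilde_def x_def l_eq power_int_def)
qed

lemma epsilon_bounds: "0 < \<epsilon>" "\<epsilon> \<le> 1 / 4"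
proof -
  show "0 < \<epsilon>" using x_bounds \<delta> by (simp add: \<epsilon>_eq)
  have "1 \<le> nat \<lfloor>X\<rfloor>" using X_ge_2 by linarith
  then have "(1 - \<delta>) ^ nat \<lfloor>X\<rfloor> \<le> (1 - \<delta>) ^ 1" using \<delta> by (intro power_decreasing) auto
  then have "\<epsilon> \<le> \<delta> * (1 - \<delta>)" unfolding \<epsilon>_eq using x_bounds \<delta> by (intro mult_mono) auto
  also have "\<dots> \<le> 1 / 4" using zero_le_power2[of "\<delta> - 1 / 2"] by (simp add: power2_eq_square algebra_simps)
  finally show "\<epsilon> \<le> 1 / 4" .
qed

text \<open>The decisive comparison: \<open>\<epsilon>\<close> is at most \<open>\<delta> ^ m\<close> for the block length \<open>m\<close>. The
exponent of \<open>1 - \<delta>\<close> in \<open>\<epsilon>\<close> is about \<open>T / r\<close>, and since \<open>L\<close> is at most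
\<open>- ln (1 - \<delta>)\<close> this contributes about \<open>T (G + L) / (s\<^sup>2 \<Lambda>)\<close> to \<open>- ln \<epsilon>\<close>; the part with
\<open>L\<close> covers the rounding of the exponent. In the other part
\<open>G / s\<^sup>2 \<ge> H\<close> while \<open>T\<close> exceeds \<open>- ln \<delta>\<close> by at least
\<open>2 G\<close>.\<close>

lemma ln_epsilon_le: "- ln \<epsilon> \<ge> - ln \<delta> * (1 + H / \<Lambda>)"
proof -
  let ?d = "- ln \<delta>" and ?M = "- ln (1 - \<delta>)" and ?c = "ln 2 / 2 :: real"
  have d: "0 \<le> ?d" "?d \<le> - ln x" using \<delta> x_bounds by auto
  have M: "L \<le> ?M" "0 < ?M" using L_bounds by auto
  have c: "0 \<le> ?c" "?c \<le> 1 / 2" using ln2_bounds by auto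
  have "ln \<epsilon> = ln x + real (nat \<lfloor>X\<rfloor>) * ln (1 - \<delta>)"
    unfolding \<epsilon>_eq using x_bounds \<delta> by (simp add: ln_mult ln_realpow)
  then have E: "- ln \<epsilon> = - ln x + real (nat \<lfloor>X\<rfloor>) * ?M" by simp
  have floor: "L * (X - 1) \<le> ?M * real (nat \<lfloor>X\<rfloor>)"
    using M L_bounds X_ge_2 by (intro mult_mono) linarith+
  have len: "(T - ?c) * G / (s\<^sup>2 * \<Lambda>) \<le> L * (X - 1)"
  proof -
    have "s * s * \<Lambda> \<le> 1 * (s * \<Lambda>)" using s_bounds Lambda_pos by (simp only: mult.assoc) (intro mult_right_mono, auto)
    then have "s\<^sup>2 * \<Lambda> \<le> T - ?c" using G_ge_\<Lambda> T_ge_ln2 ln2_bounds by (simp add: power2_eq_square)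
    then have "1 \<le> (T - ?c) / (s\<^sup>2 * \<Lambda>)" using s_bounds Lambda_pos by simp
    then have "L * 1 \<le> L * ((T - ?c) / (s\<^sup>2 * \<Lambda>))" using L_bounds by (intro mult_left_mono) auto
    moreover have "L * ((T - ?c) / r) = (T - ?c) * G / (s\<^sup>2 * \<Lambda>) + L * ((T - ?c) / (s\<^sup>2 * \<Lambda>))"
      unfolding r_eq using L_bounds(1) s_bounds Lambda_pos G_pos by (simp add: field_simps)
    moreover have "L * ((T - ?c) / r) \<le> L * X" using X_ge L_bounds by (intro mult_left_mono) auto
    ultimately show ?thesis by (simp add: right_diff_distrib)
  qed
  have key: "?d * H \<le> (T - ?c) * (G / s\<^sup>2)"
  proof (cases "1 / 4 \<le> G")
    case True
    \<comment> \<open>The surplus \<open>2 G\<close> in \<open>T\<close> pays for the loss \<open>?c\<close> caused by \<open>q\<close>.\<close>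
    have "H \<le> G / s\<^sup>2" using G_ge_H s_bounds by (simp add: field_simps)
    moreover have "?d \<le> T - ?c" using True T_ge_x d c by linarith
    ultimately show ?thesis using d H_ge by (intro mult_mono) auto
  next
    case False
    \<comment> \<open>A small \<open>G\<close> forces a small \<open>s\<close>, and then \<open>G / s\<^sup>2\<close> is even twice \<open>H\<close>.\<close>
    have sG: "s + ln (D / \<rho>) \<le> G"
      using G_ge_drift ln_le_minus_one[of \<gamma>] \<gamma> by (simp add: s_def)
    then have s4: "s \<le> 1 / 4" using False D_div_rho by linarith
    then have "s * s \<le> 1 / 4 * s" "s * s \<le> 1 / 4 * (1 / 4)"
      using s_bounds by (intro mult_mono; simp)+
    moreover from this(2) have "16 * (s * s) * ln (D / \<rho>) \<le> 1 * ln (D / \<rho>)"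
      using D_div_rho by (intro mult_right_mono) auto
    moreover have "0 \<le> s * s * ln (D / \<rho>)" using D_div_rho by simp
    ultimately have "2 * H * (s * s) \<le> s + ln (D / \<rho>)"
      unfolding H_def by (simp add: algebra_simps)
    then have "2 * H * s\<^sup>2 \<le> G" using sG by (simp add: power2_eq_square)
    then have "2 * H \<le> G / s\<^sup>2" using s_bounds by (simp add: field_simps)
    moreover have "?d / 2 \<le> T - ?c" using T_ge_x T_ge_ln2 G_pos d by linarith
    ultimately have "?d / 2 * (2 * H) \<le> (T - ?c) * (G / s\<^sup>2)" using d H_ge by (intro mult_mono) auto
    then show ?thesis by simp
  qed
  have "?d * H / \<Lambda> \<le> (T - ?c) * (G / s\<^sup>2) / \<Lambda>"
    using Lambda_pos(1) key by (intro divide_right_mono) auto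
  then have "?d * H / \<Lambda> \<le> (T - ?c) * G / (s\<^sup>2 * \<Lambda>)"
    by (simp only: times_divide_eq_right divide_divide_eq_left)
  then have "?d * H / \<Lambda> \<le> ?M * real (nat \<lfloor>X\<rfloor>)" using floor len by linarith
  then show ?thesis unfolding E using d by (simp add: algebra_simps)
qed

lemma A_ge: "exp T \<le> A" "1 \<le> A"
proof -
  let ?p = "(1 - exp (- r)) * (1 - exp (- \<gamma> * r))"
  have p: "0 < 1 - exp (- r)" "0 < 1 - exp (- \<gamma> * r)" using r_bounds \<gamma> by auto
  have "?p \<le> 1 * 1" using p by (intro mult_mono) auto
  moreover have "0 < ?p" using p by (rule mult_pos_pos)
  moreover have "0 \<le> v * B" using v vB_ge(3) by simp
  ultimately have "(v * B + 1) / 1 \<le> (v * B + 1) / ?p" by (intro divide_left_mono) auto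
  then have "v * B + 1 \<le> A" by (simp add: A_tilde_def)
  then show "exp T \<le> A" by (simp add: exp_T)
  have "1 \<le> exp T" using T_pos by simp
  then show "1 \<le> A" using \<open>exp T \<le> A\<close> by (rule order_trans)
qed

lemma rho1_bounds: "0 < \<rho>\<^sub>1" "\<rho>\<^sub>1 \<le> 8 / 9 * ln 2 * s\<^sup>2 * \<epsilon> / T"
proof -
  let ?N = "\<bar>ln (1 - \<epsilon>)\<bar>" and ?rt = "r_tilde \<gamma> \<rho> \<delta> D \<eta> v"
  let ?W = "ln A + r * real_of_int l"
  have eq: "\<rho>\<^sub>1 = s\<^sup>2 * ?rt * ?N / (?W + ?N)"
    by (simp add: rho1_tilde_def s_def)
  have rt: "0 < ?rt" "?rt \<le> ln 2"
  proof -
    have "ln (1 - q) < 0" using q_bounds by simp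
    then show "0 < ?rt" by (simp add: r_tilde_def)
    have "ln (1 / 2) \<le> ln (1 - q)" using q_bounds by (intro ln_mono) auto
    then show "?rt \<le> ln 2" using \<open>ln (1 - q) < 0\<close> by (simp add: r_tilde_def ln_div)
  qed
  have N: "0 < ?N" "?N \<le> 4 / 3 * \<epsilon>"
  proof -
    have neg: "ln (1 - \<epsilon>) < 0" using epsilon_bounds by simp
    then show "0 < ?N" by simp
    have "ln (1 / (1 - \<epsilon>)) \<le> 1 / (1 - \<epsilon>) - 1" using epsilon_bounds by (intro ln_le_minus_one) auto
    also have "\<dots> = \<epsilon> / (1 - \<epsilon>)" using epsilon_bounds by (simp add: field_simps)
    also have "\<dots> \<le> \<epsilon> / (3 / 4)" using epsilon_bounds by (intro divide_left_mono) auto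
    finally show "?N \<le> 4 / 3 * \<epsilon>" using neg epsilon_bounds by (simp add: ln_div)
  qed
  have W: "3 / 2 * T \<le> ?W"
  proof -
    have "T \<le> ln A" using A_ge by (simp add: ln_ge_iff)
    moreover have "(T - ln 2 / 2) / r \<le> real_of_int l" using X_ge l_eq by linarith
    then have "T - ln 2 / 2 \<le> r * real_of_int l" using r_bounds by (simp add: field_simps)
    ultimately show ?thesis using T_ge_ln2 G_pos by linarith
  qed
  have W0: "0 < ?W" using W T_pos by linarith
  show "0 < \<rho>\<^sub>1" unfolding eq using s_bounds rt N W0 by simp
  have "?N / (?W + ?N) \<le> 4 / 3 * \<epsilon> / (3 / 2 * T)"
    using N W T_pos by (intro frac_le) auto
  then have "?rt * (?N / (?W + ?N)) \<le> ln 2 * (4 / 3 * \<epsilon> / (3 / 2 * T))"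
    using rt N W0 by (intro mult_mono) auto
  then have "s\<^sup>2 * (?rt * (?N / (?W + ?N))) \<le> s\<^sup>2 * (ln 2 * (4 / 3 * \<epsilon> / (3 / 2 * T)))"
    by (intro mult_left_mono) auto
  then show "\<rho>\<^sub>1 \<le> 8 / 9 * ln 2 * s\<^sup>2 * \<epsilon> / T"
    unfolding eq by (simp add: mult.assoc mult.left_commute)
qed

text \<open>The rate is at most a constant times \<open>s ^ 3 \<epsilon> r / T\<^sup>2\<close>, and
\<open>r \<le> s\<^sup>2 \<Lambda> / 2\<close>. Because \<open>G\<close> dominates both \<open>s \<Lambda>\<close> and
\<open>s\<^sup>2 H\<close>, while \<open>T\<^sup>2 \<ge> (G + ln 2)\<^sup>2 \<ge> 4 G ln 2\<close>, the denominator \<open>T\<^sup>2\<close>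
compensates for the factor \<open>\<Lambda> + H\<close>; the quotient \<open>\<Lambda> / (\<Lambda> + H)\<close> is the
reciprocal of the bound \<open>1 + H / \<Lambda>\<close> for the block length.\<close>

lemma kappa_bounds: "0 < \<kappa>" "\<kappa> \<le> \<epsilon> * \<Lambda> / (8 * (\<Lambda> + H))"
proof -
  have eq: "\<kappa> = s * \<rho>\<^sub>1 * r / (2 * (\<rho>\<^sub>1 + T))" by (simp add: kappa_star_def s_def T_def)
  show "0 < \<kappa>" unfolding eq using s_bounds rho1_bounds r_bounds T_pos by simp
  have "\<kappa> \<le> s * \<rho>\<^sub>1 * r / (2 * T)"
    unfolding eq using s_bounds rho1_bounds r_bounds T_pos by (intro divide_left_mono) auto
  also have "\<dots> \<le> s * (8 / 9 * ln 2 * s\<^sup>2 * \<epsilon> / T) * (s\<^sup>2 * \<Lambda> / 2) / (2 * T)"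
    using s_bounds rho1_bounds r_bounds T_pos epsilon_bounds by (intro divide_right_mono mult_mono mult_nonneg_nonneg) auto
  also have "\<dots> = (2 / 9 * ln 2 * s ^ 5 / T\<^sup>2) * (\<epsilon> * \<Lambda>)"
    by (simp add: power2_eq_square eval_nat_numeral)
  also have "\<dots> \<le> 1 / (8 * (\<Lambda> + H)) * (\<epsilon> * \<Lambda>)"
  proof (intro mult_right_mono)
    have "s ^ 4 * (s * \<Lambda>) \<le> 1 * G" using s_bounds Lambda_pos G_ge_\<Lambda> by (intro mult_mono power_le_one) auto
    moreover have "s ^ 3 * (s\<^sup>2 * H) \<le> 1 * G" using s_bounds H_ge G_ge_H by (intro mult_mono power_le_one) auto
    ultimately have "s ^ 5 * (\<Lambda> + H) \<le> 2 * G"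
      by (simp add: eval_nat_numeral algebra_simps)
    then have "16 / 9 * ln 2 * (s ^ 5 * (\<Lambda> + H)) \<le> 16 / 9 * ln 2 * (2 * G)"
      using ln2_bounds by (intro mult_left_mono) auto
    also have "\<dots> \<le> 8 / 9 * (4 * G * ln 2)" by simp
    also have "\<dots> \<le> 1 * (G + ln 2)\<^sup>2"
      using zero_le_power2[of "G - ln 2"] G_pos ln2_bounds
      by (intro mult_mono) (auto simp: power2_eq_square algebra_simps)
    also have "(G + ln 2)\<^sup>2 \<le> T\<^sup>2" using T_ge_ln2 G_pos ln2_bounds by (intro power_mono) auto
    finally have "16 / 9 * ln 2 * (s ^ 5 * (\<Lambda> + H)) \<le> T\<^sup>2" by simp
    then have "2 / 9 * ln 2 * s ^ 5 * (8 * (\<Lambda> + H)) \<le> T\<^sup>2" by (simp add: algebra_simps)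
    then show "2 / 9 * ln 2 * s ^ 5 / T\<^sup>2 \<le> 1 / (8 * (\<Lambda> + H))"
      using T_pos Lambda_pos H_ge by (simp add: field_simps)
  qed (use epsilon_bounds Lambda_pos in auto)
  finally show "\<kappa> \<le> \<epsilon> * \<Lambda> / (8 * (\<Lambda> + H))" by simp
qed

lemma kappa_star_le:
  assumes m: "0 < m" "real m \<le> 1 + H / \<Lambda>"
  shows "\<kappa> \<le> \<delta> ^ m / (8 * real m)"
proof -
  have "- ln \<delta> * real m \<le> - ln \<delta> * (1 + H / \<Lambda>)" using \<delta> m by (intro mult_left_mono) auto
  then have "ln \<epsilon> \<le> real m * ln \<delta>" using ln_epsilon_le by (simp add: mult.commute)
  also have "\<dots> = ln (\<delta> ^ m)" using \<delta> by (simp add: ln_realpow)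
  finally have "\<epsilon> \<le> \<delta> ^ m" using epsilon_bounds \<delta> by simp
  moreover have "\<Lambda> / (\<Lambda> + H) \<le> 1 / real m"
    using m Lambda_pos H_ge by (simp add: field_simps)
  ultimately have "\<epsilon> * (\<Lambda> / (\<Lambda> + H)) \<le> \<delta> ^ m * (1 / real m)"
    using epsilon_bounds Lambda_pos H_ge \<delta> by (intro mult_mono) auto
  then have "1 / 8 * (\<epsilon> * (\<Lambda> / (\<Lambda> + H))) \<le> 1 / 8 * (\<delta> ^ m * (1 / real m))"
    by (rule mult_left_mono) simp
  also have "1 / 8 * (\<epsilon> * (\<Lambda> / (\<Lambda> + H))) = \<epsilon> * \<Lambda> / (8 * (\<Lambda> + H))" by simp
  finally have "\<epsilon> * \<Lambda> / (8 * (\<Lambda> + H)) \<le> \<delta> ^ m / (8 * real m)" by simp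
  then show ?thesis using kappa_bounds(2) by (rule order_trans[rotated])
qed

text \<open>The denominator \<open>exp \<kappa> - 1\<close> is at most \<open>2 \<kappa>\<close>, and \<open>B \<ge> U \<ge> D / \<rho>\<close>.\<close>

lemma R_star_ge:
  assumes \<kappa>1: "\<kappa> \<le> 1"
  shows "3 * (D / \<rho>) / \<kappa> \<le> R"
proof -
  let ?e = "exp \<kappa>"
  have e: "1 < ?e" "?e - 1 \<le> 2 * \<kappa>"
  proof -
    show "1 < ?e" using kappa_bounds by simp
    have "\<kappa>\<^sup>2 \<le> \<kappa>" using kappa_bounds \<kappa>1 by (simp add: power2_eq_square mult_le_one)
    then show "?e - 1 \<le> 2 * \<kappa>" using exp_bound[of \<kappa>] kappa_bounds \<kappa>1 by simp
  qed
  have A3: "1 \<le> A3_tilde \<gamma> \<rho> \<delta> D \<eta> v"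
  proof -
    have "(1 - \<epsilon>) powr \<gamma> \<le> 1" using epsilon_bounds \<gamma> by (intro powr_le1) auto
    then have "0 \<le> (1 - \<gamma>) / \<gamma> * (3 + 2 * (exp r * A * (1 + A * exp (r * of_int l))
        / ((1 - (1 - \<epsilon>) powr \<gamma>) * (exp r - 1)))) * v * B"
      using \<gamma> A_ge r_bounds v vB_ge(3)
      by (intro mult_nonneg_nonneg divide_nonneg_nonneg add_nonneg_nonneg) auto
    moreover have "0 \<le> kappa_tilde \<gamma> \<rho> \<delta> D \<eta> v"
      using s_bounds rho1_bounds r_bounds T_pos unfolding kappa_tilde_def T_def[symmetric] s_def[symmetric] by simp
    ultimately show ?thesis unfolding A3_tilde_def using one_le_exp_iff[of "kappa_tilde \<gamma> \<rho> \<delta> D \<eta> v"]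
      by linarith
  qed
  have "D / \<rho> \<le> B" using U_ge(4) vB_ge(2) by simp
  then have "D / \<rho> * 1 \<le> v * B * B" using v vB_ge(3) D_div_rho by (intro mult_mono) (auto simp: mult_ge1_I intro: order_trans)
  then have vBB: "D / \<rho> \<le> v * B\<^sup>2" by (simp add: power2_eq_square)
  have "2 * 1 \<le> (A3_tilde \<gamma> \<rho> \<delta> D \<eta> v + 1) * ?e" using A3 e by (intro mult_mono) auto
  then have "3 / (2 * \<kappa>) \<le> ((A3_tilde \<gamma> \<rho> \<delta> D \<eta> v + 1) * ?e + 1) / (?e - 1)"
    using e kappa_bounds by (intro frac_le) auto
  then have "3 / (2 * \<kappa>) * (D / \<rho>) \<le> ((A3_tilde \<gamma> \<rho> \<delta> D \<eta> v + 1) * ?e + 1) / (?e - 1) * (v * B\<^sup>2)"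
    using vBB D \<rho> A3 e(1) by (intro mult_mono divide_nonneg_pos add_nonneg_nonneg mult_nonneg_nonneg) auto
  then have "2 * (3 / (2 * \<kappa>) * (D / \<rho>))
      \<le> 2 * (((A3_tilde \<gamma> \<rho> \<delta> D \<eta> v + 1) * ?e + 1) / (?e - 1) * (v * B\<^sup>2))"
    by (rule mult_left_mono) simp
  also have "\<dots> = R" by (simp only: R_star_def mult.assoc)
  finally show ?thesis by (simp add: mult.commute)
qed

end

lemma exp_2_ge_7: "7 \<le> exp (2::real)"
proof -
  have "1 + 1 / 4 + (1 / 4)\<^sup>2 / 2 \<le> exp (1 / 4 :: real)" by (rule exp_lower_Taylor_quadratic) simp
  then have "(41 / 32) ^ 8 \<le> exp (1 / 4 :: real) ^ 8"
    by (intro power_mono) (simp_all add: power2_eq_square)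
  also have "\<dots> = exp 2" by (simp add: exp_of_nat_mult[symmetric])
  finally show ?thesis by (simp add: eval_nat_numeral)
qed

text \<open>The number \<open>H\<close> contains the summand \<open>2\<close> because \<open>exp 2\<close> exceeds the factor \<open>7\<close>
in the last inequality.\<close>

lemma (in rate_parameters) block_length_exists:
  obtains m where "0 < m" "real m \<le> 1 + H / \<Lambda>" "7 * (1 - \<rho>) ^ m \<le> \<rho> / D"
proof -
  define m where "m = nat \<lceil>H / \<Lambda>\<rceil>"
  have pos: "0 < H / \<Lambda>" using H_ge Lambda_pos by simp
  have m: "H / \<Lambda> \<le> real m" "real m \<le> 1 + H / \<Lambda>" "0 < m"
    using pos unfolding m_def by linarith+
  have "(1 - \<rho>) ^ m = exp (- (real m * \<Lambda>))"
    unfolding Lambda_pos(3) by (simp add: exp_of_nat_mult[symmetric])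
  also have "\<dots> \<le> exp (- H)" using m(1) Lambda_pos(1) by (simp add: pos_divide_le_eq)
  also have "exp (- H) = (\<rho> / D) / exp 2"
    using \<rho> D by (simp add: H_def exp_diff exp_minus exp_add field_simps)
  also have "\<dots> \<le> (\<rho> / D) / 7" using exp_2_ge_7 \<rho> D by (intro divide_left_mono) auto
  finally have "7 * (1 - \<rho>) ^ m \<le> \<rho> / D" by simp
  then show thesis using that m by blast
qed

section \<open>Uniform geometric ergodicity\<close>

theorem theorem2p1:
  fixes M :: "'a measure"
    and P :: "'t \<Rightarrow> 'a \<Rightarrow> 'a measure" and \<Theta> :: "'t set"
    and C :: "'a set" and \<nu> :: "'a measure" and V :: "'a \<Rightarrow> real"
    and \<delta> \<rho> D Vstar \<eta> :: real
  assumes kernel: "\<And>\<theta>. \<theta> \<in> \<Theta> \<Longrightarrow> transition_prob M (P \<theta>)"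
    and C: "C \<in> sets M"
    and delta: "0 < \<delta>" "\<delta> < 1"
    and nu: "prob_space \<nu>" "sets \<nu> = sets M" "measure \<nu> C = 1"
    and minorization: "\<And>A. A \<in> sets M \<Longrightarrow> measure \<nu> A > 0 \<Longrightarrow>
      (INF x\<in>C. (INF \<theta>\<in>\<Theta>. measure (P \<theta> x) A) - \<delta> * measure \<nu> A) > 0"
    and V: "V \<in> borel_measurable M" "\<And>x. x \<in> space M \<Longrightarrow> 1 \<le> V x"
    and rho: "0 < \<rho>" "\<rho> < 1"
    and D: "1 \<le> D"
    and V_bdd: "bdd_above (V ` C)"
    and drift: "\<And>x. x \<in> space M \<Longrightarrow>
      (SUP \<theta>\<in>\<Theta>. \<integral>\<^sup>+ \<omega>. ennreal (V (\<omega> 1)) \<partial>chain_law M (P \<theta>) x)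
        \<le> ennreal ((1 - \<rho>) * V x + D * indicator C x)"
    and Vstar: "Vstar = (SUP x\<in>C. V x)"
    and eta: "\<eta> = (INF x\<in>C. (INF \<theta>\<in>\<Theta>. measure (P \<theta> x) C) - \<delta>)"
  shows "\<exists>\<pi> :: 't \<Rightarrow> 'a measure.
    (\<forall>\<theta>\<in>\<Theta>. invariant_distribution M (P \<theta>) (\<pi> \<theta>) \<and> integrable (\<pi> \<theta>) V) \<and>
    (\<forall>\<gamma> n. 0 < \<gamma> \<longrightarrow> \<gamma> < 1 \<longrightarrow> 2 \<le> n \<longrightarrow>
      (SUP \<theta>\<in>\<Theta>. SUP x\<in>space M.
         SUP f\<in>{f \<in> borel_measurable M. \<forall>z\<in>space M. 0 < f z \<and> f z \<le> V z}.
           ereal (1 / V x * \<bar>(\<integral>\<omega>. f (\<omega> n) \<partial>chain_law M (P \<theta>) x) - (\<integral>z. f z \<partial>\<pi> \<theta>)\<bar>))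
        \<le> ereal (R_star \<gamma> \<rho> \<delta> D \<eta> Vstar * exp (- kappa_star \<gamma> \<rho> \<delta> D \<eta> Vstar * real n)))"
proof -
  have C_ne: "C \<noteq> {}" using nu(3) by auto
  then obtain x0 where x0: "x0 \<in> C" by auto
  have C_space: "x \<in> space M" if "x \<in> C" for x
    using sets.sets_into_space[OF C] that by auto
  have minor: "\<delta> * measure \<nu> A \<le> measure (P \<theta> x) A"
    if \<theta>: "\<theta> \<in> \<Theta>" and x: "x \<in> C" and A: "A \<in> sets M" for \<theta> x A
  proof (cases "0 < measure \<nu> A")
    case True
    have bdd: "bdd_below ((\<lambda>\<theta>. measure (P \<theta> y) A) ` \<Theta>)" for y
      by (intro bdd_belowI2[of _ 0]) simp
    have nonneg: "0 \<le> (INF \<theta>\<in>\<Theta>. measure (P \<theta> y) A)" for y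
      using \<theta> by (intro cINF_greatest) auto
    have "0 < (INF x\<in>C. (INF \<theta>\<in>\<Theta>. measure (P \<theta> x) A) - \<delta> * measure \<nu> A)"
      by (rule minorization[OF A True])
    also have "\<dots> \<le> (INF \<theta>\<in>\<Theta>. measure (P \<theta> x) A) - \<delta> * measure \<nu> A"
      using nonneg by (intro cINF_lower x bdd_belowI2[of _ "- (\<delta> * measure \<nu> A)"]) auto
    finally have "\<delta> * measure \<nu> A \<le> (INF \<theta>\<in>\<Theta>. measure (P \<theta> x) A)" by simp
    also have "\<dots> \<le> measure (P \<theta> x) A" using bdd \<theta> by (rule cINF_lower)
    finally show ?thesis .
  next
    case False
    then have "measure \<nu> A = 0" using measure_nonneg[of \<nu> A] by linarith
    then show ?thesis by simp
  qed
  have rho': "0 < 1 - \<rho>" "1 - \<rho> < 1" using rho by simp_all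
  have harris: "harris_kernel M (P \<theta>) C \<nu> V \<delta> (1 - \<rho>) D" if \<theta>: "\<theta> \<in> \<Theta>" for \<theta>
  proof (rule harris_kernel.intro)
    show K: "P \<theta> \<in> M \<rightarrow>\<^sub>M prob_algebra M" using kernel[OF \<theta>] by (simp add: transition_prob_def)
    show "(\<integral>\<^sup>+y. ennreal (V y) \<partial>P \<theta> x) \<le> ennreal ((1 - \<rho>) * V x + D * indicator C x)"
      if x: "x \<in> space M" for x
    proof -
      have m: "(\<lambda>\<omega>. \<omega> 1) \<in> chain_law M (P \<theta>) x \<rightarrow>\<^sub>M M"
        unfolding measurable_cong_sets[OF sets_chain_law[OF kernel[OF \<theta>] x] refl]
        by (rule measurable_component_singleton) auto
      have V': "(\<lambda>y. ennreal (V y)) \<in> borel_measurable M" using V(1) by simp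
      have law1: "P \<theta> x = distr (chain_law M (P \<theta>) x) M (\<lambda>\<omega>. \<omega> 1)"
        using distr_chain_law[OF kernel[OF \<theta>] x, of 1] kernel_pow_1[OF K x] by simp
      have "(\<integral>\<^sup>+y. ennreal (V y) \<partial>P \<theta> x) = (\<integral>\<^sup>+\<omega>. ennreal (V (\<omega> 1)) \<partial>chain_law M (P \<theta>) x)"
        unfolding law1 using nn_integral_distr[OF m, of "\<lambda>y. ennreal (V y)"] V'
        by (simp only: measurable_distr_eq1)
      also have "\<dots> \<le> (SUP \<theta>\<in>\<Theta>. \<integral>\<^sup>+ \<omega>. ennreal (V (\<omega> 1)) \<partial>chain_law M (P \<theta>) x)"
        using \<theta> by (intro SUP_upper)
      finally show ?thesis using drift[OF x] by (rule order_trans)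
    qed
  qed (rule C nu delta minor[OF \<theta>] V rho' D | assumption)+
  have params: "rate_parameters \<gamma> \<rho> \<delta> D \<eta> Vstar" if \<gamma>: "0 < \<gamma>" "\<gamma> < 1" and \<theta>: "\<theta> \<in> \<Theta>" for \<gamma> \<theta>
  proof
    show "0 < \<eta>" using minorization[OF C] nu(3) by (simp add: eta)
    have nonneg: "0 \<le> (INF \<theta>\<in>\<Theta>. measure (P \<theta> y) C)" for y
      using \<theta> by (intro cINF_greatest) auto
    have "\<eta> \<le> (INF \<theta>\<in>\<Theta>. measure (P \<theta> x0) C) - \<delta>"
      unfolding eta using nonneg x0 by (intro cINF_lower bdd_belowI2[of _ "- \<delta>"]) auto
    also have "(INF \<theta>\<in>\<Theta>. measure (P \<theta> x0) C) \<le> measure (P \<theta> x0) C"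
      using \<theta> by (intro cINF_lower bdd_belowI2[of _ 0]) auto
    also have "\<dots> \<le> 1"
      using prob_kernelD(1)[OF _ C_space[OF x0]] kernel[OF \<theta>]
      by (intro prob_space.prob_le_1) (auto simp: transition_prob_def)
    finally show "\<eta> \<le> 1 - \<delta>" by simp
    have "1 \<le> V x0" using V(2) C_space[OF x0] by simp
    also have "\<dots> \<le> Vstar" unfolding Vstar using x0 V_bdd by (rule cSUP_upper)
    finally show "1 \<le> Vstar" .
  qed (rule \<gamma> rho delta D)+
  have "\<exists>\<pi>. \<forall>\<theta>\<in>\<Theta>. invariant_distribution M (P \<theta>) (\<pi> \<theta>) \<and> integrable (\<pi> \<theta>) V
      \<and> (\<integral>z. V z \<partial>\<pi> \<theta>) \<le> D / \<rho>"
  proof (intro bchoice ballI)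
    fix \<theta> assume \<theta>: "\<theta> \<in> \<Theta>"
    interpret c: rate_parameters "1 / 2" \<rho> \<delta> D \<eta> Vstar using params[OF _ _ \<theta>, of "1 / 2"] by simp
    obtain m where "0 < m" "7 * (1 - \<rho>) ^ m \<le> \<rho> / D" by (rule c.block_length_exists)
    then interpret K: harris_contraction M "P \<theta>" C \<nu> V \<delta> "1 - \<rho>" D m
      using harris[OF \<theta>] by (auto simp: harris_contraction_def harris_contraction_axioms_def)
    from K.invariant_distribution_exists[OF C_space[OF x0]]
    show "\<exists>\<pi>. invariant_distribution M (P \<theta>) \<pi> \<and> integrable \<pi> V \<and> (\<integral>z. V z \<partial>\<pi>) \<le> D / \<rho>"
      by auto
  qed
  then obtain \<pi> where \<pi>: "\<And>\<theta>. \<theta> \<in> \<Theta> \<Longrightarrow> invariant_distribution M (P \<theta>) (\<pi> \<theta>)"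
    "\<And>\<theta>. \<theta> \<in> \<Theta> \<Longrightarrow> integrable (\<pi> \<theta>) V" "\<And>\<theta>. \<theta> \<in> \<Theta> \<Longrightarrow> (\<integral>z. V z \<partial>\<pi> \<theta>) \<le> D / \<rho>"
    by blast
  show ?thesis
  proof (intro exI[of _ \<pi>] conjI allI impI SUP_least ballI)
    fix \<theta> assume "\<theta> \<in> \<Theta>"
    then show "invariant_distribution M (P \<theta>) (\<pi> \<theta>)" "integrable (\<pi> \<theta>) V" by (rule \<pi>)+
  next
    fix \<gamma> :: real and n :: nat and \<theta> x and f :: "'a \<Rightarrow> real"
    assume \<gamma>: "0 < \<gamma>" "\<gamma> < 1" and \<theta>: "\<theta> \<in> \<Theta>" and x: "x \<in> space M"
      and f: "f \<in> {f \<in> borel_measurable M. \<forall>z\<in>space M. 0 < f z \<and> f z \<le> V z}"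
    interpret c: rate_parameters \<gamma> \<rho> \<delta> D \<eta> Vstar by (rule params[OF \<gamma> \<theta>])
    obtain m where m: "0 < m" "real m \<le> 1 + c.H / c.\<Lambda>" "7 * (1 - \<rho>) ^ m \<le> \<rho> / D"
      by (rule c.block_length_exists)
    interpret K: harris_contraction M "P \<theta>" C \<nu> V \<delta> "1 - \<rho>" D m
      using harris[OF \<theta>] m by (auto simp: harris_contraction_def harris_contraction_axioms_def)
    have km: "c.\<kappa> \<le> \<delta> ^ m / (8 * real m)" by (rule c.kappa_star_le[OF m(1,2)])
    have "\<delta> ^ m / (8 * real m) \<le> 1 / 1" using K.delta_m m(1) by (intro frac_le) auto
    then have k1: "c.\<kappa> \<le> 1" using km by simp
    have cm: "(\<lambda>\<omega>. \<omega> n) \<in> chain_law M (P \<theta>) x \<rightarrow>\<^sub>M M"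
      unfolding measurable_cong_sets[OF sets_chain_law[OF kernel[OF \<theta>] x] refl]
      by (rule measurable_component_singleton) auto
    have E: "(\<integral>\<omega>. f (\<omega> n) \<partial>chain_law M (P \<theta>) x) = (\<integral>z. f z \<partial>kernel_pow M (P \<theta>) n x)"
      unfolding distr_chain_law[OF kernel[OF \<theta>] x, symmetric]
      using f by (intro integral_distr[symmetric] cm) auto
    have V1: "1 \<le> V x" using V(2)[OF x] .
    have "\<bar>(\<integral>\<omega>. f (\<omega> n) \<partial>chain_law M (P \<theta>) x) - (\<integral>z. f z \<partial>\<pi> \<theta>)\<bar>
        \<le> K.decay n * (2 / K.\<beta> + V x + D / (1 - (1 - \<rho>)))"
      unfolding E using \<pi> \<theta> f x by (intro K.geometric_ergodicity) (auto intro: less_imp_le)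
    also have "\<dots> \<le> V x * (3 * (D / (1 - (1 - \<rho>))) / c.\<kappa> * exp (- c.\<kappa> * real n))"
      by (rule K.rate_to_exponential[OF c.kappa_bounds(1) km x])
    also have "\<dots> \<le> V x * (c.R * exp (- c.\<kappa> * real n))"
      using c.R_star_ge[OF k1] V1 by (intro mult_left_mono mult_right_mono) auto
    finally show "ereal (1 / V x * \<bar>(\<integral>\<omega>. f (\<omega> n) \<partial>chain_law M (P \<theta>) x) - (\<integral>z. f z \<partial>\<pi> \<theta>)\<bar>)
        \<le> ereal (c.R * exp (- c.\<kappa> * real n))"
      using V1 by (simp add: divide_le_eq mult.commute)
  qed
qed

end
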